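(* Let $s\in\mathbb{R}$ and $0<p,q\le\infty$. The matrix product of almost diagonal matrices is almost diagonal: if $\mathbf A=\{a_{(j,m)(k,n)}\}$ and $\mathbf B=\{b_{(j,m)(k,n)}\}$ belong to $\mathrm{ad}^s_{p,q}(\tilde h)$, then the product with entries $\sum_{i\in J,\,l\in\mathbb{Z}^d}a_{(j,m)(i,l)}b_{(i,l)(k,n)}$ belongs to $\mathrm{ad}^s_{p,q}(\tilde h)$; that is, $\mathrm{ad}^s_{p,q}(\tilde h)\circ\mathrm{ad}^s_{p,q}(\tilde h)\subseteq\mathrm{ad}^s_{p,q}(\tilde h)$.
   Context: Geometry. Fix $d\in\mathbb{N}$ and an anisotropy $\mathbf a=(a_1,\dots,a_d)$ with $a_i>1$ for all $i$; put $\nu=\sum_i a_i$. For $t>0$, $D_{\mathbf a}(t)=\mathrm{diag}(t^{a_1},\dots,t^{a_d})$. Set $|0|_{\mathbf a}=0$ and for $\xi\ne0$ let $|\xi|_{\mathbf a}$ be the unique $t>0$ with $|D_{\mathbf a}(1/t)\xi|=1$ ($|\cdot|$ the Euclidean norm). $B_{\mathbf a}(\xi,r)=\{\zeta\in\mathbb{R}^d:|\xi-\zeta|_{\mathbf a}<r\}$. Regulation function. A function $h:\mathbb{R}^d\setminus\{0\}\to(0,\infty)$ is d-moderate if there are $R,\delta_0>0$ such that $|\xi-\zeta|_{\mathbf a}\le\delta_0h(\xi)$ implies $R^{-1}\le h(\xi)/h(\zeta)\le R$. Fix a hybrid regulation function $\tilde h=\rho h_1+(1-\rho)h_2:\mathbb{R}^d\setminus\{0\}\to(0,\infty)$,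 where $\rho\ge0$ is of class $C^\sigma$ for some $\sigma\ge1$, $\rho(\xi)=1$ for $0<|\xi|_{\mathbf a}\le\frac23$, $\rho(\xi)=0$ for $|\xi|_{\mathbf a}\ge\frac43$, and $h_1,h_2$ are d-moderate with $c_0|\xi|_{\mathbf a}^{r_0}\le h_1(\xi)\le c_1|\xi|_{\mathbf a}$ (some $c_0,c_1>0$, $r_0\ge1$) and $c_2\le h_2(\xi)\le c_3|\xi|_{\mathbf a}$ (some $c_2,c_3>0$) on the regions where they enter $\tilde h$. $\tilde h$ is d-moderate; let $\delta_0$ be its constant. Standing assumption: there are $\beta,R_1,\rho_1>0$ such that $h_2^{1+\beta}$ is d-moderate and $|\xi-\zeta|_{\mathbf a}\le b\,h_2(\xi)$ with $b\ge\rho_1$ implies $h_2(\zeta)\le R_1b\,h_2(\xi)$. Covering. Fix $0<\delta_1<\delta_0/2$, a countably infinite index set $J$ and points $\xi_j\in\mathbb{R}^d\setminus\{0\}$ ($j\in J$) such that the balls $B_{\mathbf a}(\xi_j,\delta_1\tilde h(\xi_j))$ form an admissible covering of $\mathbb{R}^d\setminus\{0\}$ (each ball meets at most a fixed finite number of the others) and, for some $0<\delta_1'<\delta_1$, the balls $B_{\mathbf a}(\xi_j,\delta_1'\tilde h(\xi_j))$ are pairwise disjoint. Put $t_j=\tilde h(\xi_j)$, $A_j=D_{\mathbf a}(t_j)$. Fix $a>0$ such that a cube $K_a$ aligned with the axes of side-length $2a$ contains $B_{\mathbf a}(0,2\delta_1)$, and put $x_{j,n}=A_j^{-1}\frac{\pi}{a}n$,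 $j\in J$, $n\in\mathbb{Z}^d$. Almost diagonal matrices. For $s\in\mathbb{R}$, $0<p,q\le\infty$ (with $p<\infty$ when referring to the sequence space $\dot f^s_{p,q}$, $q<\infty$ when referring to $\dot m^s_{p,q}$), $r=\min(1,p,q)$, a matrix $\{a_{(j,m)(k,n)}\}_{j,k\in J,m,n\in\mathbb{Z}^d}$ belongs to $\mathrm{ad}^s_{p,q}(\tilde h)$ if there are $C,\delta>0$ such that for all indices $$|a_{(j,m)(k,n)}|\le C\Big(\frac{t_k}{t_j}\Big)^{s+\frac\nu2}\min\Big(\Big(\frac{t_j}{t_k}\Big)^{\frac\nu r+\frac\delta2},\Big(\frac{t_k}{t_j}\Big)^{\frac\delta2}\Big)c^\delta_{jk}\,(1+\min(t_k,t_j)|x_{k,n}-x_{j,m}|_{\mathbf a})^{-\frac\nu r-\delta},$$ $$c^\delta_{jk}=\min\Big(\Big(\frac{t_j}{t_k}\Big)^{\frac\nu r+\delta},\Big(\frac{t_k}{t_j}\Big)^{\delta}\Big)(1+\max(t_k,t_j)^{-1}|\xi_k-\xi_j|_{\mathbf a})^{-\frac\nu r-\delta}.$$ *)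

theory Defs
  imports "HOL-Analysis.Analysis"
begin

text \<open>
  The anisotropy is a vector \<open>\<a>\<close> indexed by the finite type \<open>'d\<close>, so that the
  dimension is \<open>CARD('d)\<close>. Functions on the punctured space are total functions on
  \<open>real ^ 'd\<close> whose value at the origin is never used.
\<close>

definition homdim :: "real ^ 'd \<Rightarrow> real" where
  "homdim \<a> = (\<Sum>i\<in>UNIV. \<a> $ i)"

definition dilation :: "real ^ 'd \<Rightarrow> real \<Rightarrow> real ^ 'd ^ 'd" where
  "dilation \<a> t = (\<chi> i j. if i = j then t powr (\<a> $ i) else 0)"

definition anorm :: "real ^ 'd \<Rightarrow> real ^ 'd \<Rightarrow> real" where
  "anorm \<a> \<xi> = (if \<xi> = 0 then 0
     else (THE t. t > 0 \<and> norm (dilation \<a> (1 / t) *v \<xi>) = 1))"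

definition aball :: "real ^ 'd \<Rightarrow> real ^ 'd \<Rightarrow> real \<Rightarrow> (real ^ 'd) set" where
  "aball \<a> \<xi> r = {\<zeta>. anorm \<a> (\<xi> - \<zeta>) < r}"

definition d_moderate_const :: "real ^ 'd \<Rightarrow> (real ^ 'd \<Rightarrow> real) \<Rightarrow> real \<Rightarrow> bool" where
  "d_moderate_const \<a> h \<delta>\<^sub>0 \<longleftrightarrow>
     \<delta>\<^sub>0 > 0 \<and> (\<forall>\<xi>. \<xi> \<noteq> 0 \<longrightarrow> h \<xi> > 0) \<and>
     (\<exists>R>0. \<forall>\<xi> \<zeta>. \<xi> \<noteq> 0 \<longrightarrow> \<zeta> \<noteq> 0 \<longrightarrow> anorm \<a> (\<xi> - \<zeta>) \<le> \<delta>\<^sub>0 * h \<xi> \<longrightarrow>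
        inverse R \<le> h \<xi> / h \<zeta> \<and> h \<xi> / h \<zeta> \<le> R)"

definition d_moderate :: "real ^ 'd \<Rightarrow> (real ^ 'd \<Rightarrow> real) \<Rightarrow> bool" where
  "d_moderate \<a> h \<longleftrightarrow> (\<exists>\<delta>\<^sub>0. d_moderate_const \<a> h \<delta>\<^sub>0)"

text \<open>Class \<open>C\<^sup>k\<close> on an open set, by iterated partial derivatives.\<close>

primrec class_C_on :: "nat \<Rightarrow> (real ^ 'd) set \<Rightarrow> (real ^ 'd \<Rightarrow> real) \<Rightarrow> bool" where
  "class_C_on 0 S f \<longleftrightarrow> continuous_on S f"
| "class_C_on (Suc k) S f \<longleftrightarrow> f differentiable_on S \<and>
     (\<forall>i. class_C_on k S (\<lambda>x. frechet_derivative f (at x) (axis i 1)))"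

text \<open>
  The growth bounds on \<open>h\<^sub>1\<close> and \<open>h\<^sub>2\<close> are required only where the respective
  coefficient \<open>\<rho>\<close>, \<open>1 - \<rho>\<close> does not vanish; for \<open>r\<^sub>0 > 1\<close> those on
  \<open>h\<^sub>1\<close> could not hold on the whole punctured space.
\<close>

definition hybrid_regulation ::
  "real ^ 'd \<Rightarrow> (real ^ 'd \<Rightarrow> real) \<Rightarrow> (real ^ 'd \<Rightarrow> real) \<Rightarrow> (real ^ 'd \<Rightarrow> real)
     \<Rightarrow> (real ^ 'd \<Rightarrow> real) \<Rightarrow> bool" where
  "hybrid_regulation \<a> \<rho> h\<^sub>1 h\<^sub>2 h \<longleftrightarrow>
     (\<forall>\<xi>. \<xi> \<noteq> 0 \<longrightarrow> \<rho> \<xi> \<ge> 0) \<and>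
     (\<exists>\<sigma>\<ge>1. class_C_on \<sigma> (- {0}) \<rho>) \<and>
     (\<forall>\<xi>. 0 < anorm \<a> \<xi> \<and> anorm \<a> \<xi> \<le> 2 / 3 \<longrightarrow> \<rho> \<xi> = 1) \<and>
     (\<forall>\<xi>. anorm \<a> \<xi> \<ge> 4 / 3 \<longrightarrow> \<rho> \<xi> = 0) \<and>
     d_moderate \<a> h\<^sub>1 \<and> d_moderate \<a> h\<^sub>2 \<and>
     (\<exists>c\<^sub>0>0. \<exists>c\<^sub>1>0. \<exists>r\<^sub>0\<ge>1. \<forall>\<xi>. \<xi> \<noteq> 0 \<and> \<rho> \<xi> \<noteq> 0 \<longrightarrow>
        c\<^sub>0 * anorm \<a> \<xi> powr r\<^sub>0 \<le> h\<^sub>1 \<xi> \<and> h\<^sub>1 \<xi> \<le> c\<^sub>1 * anorm \<a> \<xi>) \<and>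
     (\<exists>c\<^sub>2>0. \<exists>c\<^sub>3>0. \<forall>\<xi>. \<xi> \<noteq> 0 \<and> \<rho> \<xi> \<noteq> 1 \<longrightarrow>
        c\<^sub>2 \<le> h\<^sub>2 \<xi> \<and> h\<^sub>2 \<xi> \<le> c\<^sub>3 * anorm \<a> \<xi>) \<and>
     (\<forall>\<xi>. \<xi> \<noteq> 0 \<longrightarrow> h \<xi> > 0 \<and> h \<xi> = \<rho> \<xi> * h\<^sub>1 \<xi> + (1 - \<rho> \<xi>) * h\<^sub>2 \<xi>)"

definition strongly_moderate :: "real ^ 'd \<Rightarrow> (real ^ 'd \<Rightarrow> real) \<Rightarrow> bool" where
  "strongly_moderate \<a> h\<^sub>2 \<longleftrightarrow>
     (\<exists>\<beta>>0. \<exists>R\<^sub>1>0. \<exists>\<rho>\<^sub>1>0.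
        d_moderate \<a> (\<lambda>\<xi>. h\<^sub>2 \<xi> powr (1 + \<beta>)) \<and>
        (\<forall>\<xi> \<zeta> b. \<xi> \<noteq> 0 \<longrightarrow> \<zeta> \<noteq> 0 \<longrightarrow> b \<ge> \<rho>\<^sub>1 \<longrightarrow>
           anorm \<a> (\<xi> - \<zeta>) \<le> b * h\<^sub>2 \<xi> \<longrightarrow> h\<^sub>2 \<zeta> \<le> R\<^sub>1 * b * h\<^sub>2 \<xi>))"

definition admissible_covering :: "'j set \<Rightarrow> ('j \<Rightarrow> 'b set) \<Rightarrow> 'b set \<Rightarrow> bool" where
  "admissible_covering J U X \<longleftrightarrow>
     (\<Union>j\<in>J. U j) = X \<and>
     (\<exists>N::nat. \<forall>j\<in>J. finite {i \<in> J. i \<noteq> j \<and> U i \<inter> U j \<noteq> {}} \<and>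
        card {i \<in> J. i \<noteq> j \<and> U i \<inter> U j \<noteq> {}} \<le> N)"

text \<open>Closed cube with centre \<open>z\<close> and side length \<open>2 * a\<close>.\<close>

definition cube :: "real ^ 'd \<Rightarrow> real \<Rightarrow> (real ^ 'd) set" where
  "cube z a = cbox (\<chi> i. z $ i - a) (\<chi> i. z $ i + a)"

text \<open>The point \<open>x\<^sub>j\<^sub>,\<^sub>n\<close>, where \<open>t\<close> stands for \<open>t\<^sub>j\<close>.\<close>

definition sample_point :: "real ^ 'd \<Rightarrow> real \<Rightarrow> real \<Rightarrow> int ^ 'd \<Rightarrow> real ^ 'd" where
  "sample_point \<a> a t n =
     matrix_inv (dilation \<a> t) *v ((pi / a) *\<^sub>R (\<chi> i. of_int (n $ i)))"

definition rmin :: "ennreal \<Rightarrow> ennreal \<Rightarrow> real" where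
  "rmin p q = enn2real (min 1 (min p q))"

text \<open>
  In the bounds below, \<open>w\<close> stands for \<open>\<nu> / r\<close>; \<open>t\<^sub>j\<close>, \<open>t\<^sub>k\<close> and
  \<open>\<xi>\<^sub>j\<close>, \<open>\<xi>\<^sub>k\<close> are passed as arguments.
\<close>

definition ad_freq_decay ::
  "real ^ 'd \<Rightarrow> real \<Rightarrow> real \<Rightarrow> real \<Rightarrow> real \<Rightarrow> real ^ 'd \<Rightarrow> real ^ 'd \<Rightarrow> real" where
  "ad_freq_decay \<a> w \<delta> tj tk \<xi>j \<xi>k =
     min ((tj / tk) powr (w + \<delta>)) ((tk / tj) powr \<delta>) *
     (1 + inverse (max tk tj) * anorm \<a> (\<xi>k - \<xi>j)) powr (- w - \<delta>)"

definition ad_bound ::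
  "real ^ 'd \<Rightarrow> real \<Rightarrow> real \<Rightarrow> real \<Rightarrow> real \<Rightarrow> real \<Rightarrow> real \<Rightarrow> real ^ 'd \<Rightarrow> real ^ 'd
     \<Rightarrow> int ^ 'd \<Rightarrow> int ^ 'd \<Rightarrow> real" where
  "ad_bound \<a> a s w \<delta> tj tk \<xi>j \<xi>k m n =
     (tk / tj) powr (s + homdim \<a> / 2) *
     min ((tj / tk) powr (w + \<delta> / 2)) ((tk / tj) powr (\<delta> / 2)) *
     ad_freq_decay \<a> w \<delta> tj tk \<xi>j \<xi>k *
     (1 + min tk tj * anorm \<a> (sample_point \<a> a tk n - sample_point \<a> a tj m))
        powr (- w - \<delta>)"

text \<open>Matrices are total functions; only the entries with both indices in \<open>J\<close> matter.\<close>

definition almost_diagonal ::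
  "real ^ 'd \<Rightarrow> (real ^ 'd \<Rightarrow> real) \<Rightarrow> real \<Rightarrow> 'j set \<Rightarrow> ('j \<Rightarrow> real ^ 'd)
     \<Rightarrow> real \<Rightarrow> ennreal \<Rightarrow> ennreal
     \<Rightarrow> ('j \<times> (int ^ 'd) \<Rightarrow> 'j \<times> (int ^ 'd) \<Rightarrow> complex) set" where
  "almost_diagonal \<a> h a J \<xi> s p q =
     {A. \<exists>C>0. \<exists>\<delta>>0. \<forall>j\<in>J. \<forall>k\<in>J. \<forall>m n.
        norm (A (j, m) (k, n)) \<le>
          C * ad_bound \<a> a s (homdim \<a> / rmin p q) \<delta> (h (\<xi> j)) (h (\<xi> k)) (\<xi> j) (\<xi> k) m n}"

definition matrix_product ::
  "'j set \<Rightarrow> ('j \<times> (int ^ 'd) \<Rightarrow> 'j \<times> (int ^ 'd) \<Rightarrow> complex)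
     \<Rightarrow> ('j \<times> (int ^ 'd) \<Rightarrow> 'j \<times> (int ^ 'd) \<Rightarrow> complex)
     \<Rightarrow> 'j \<times> (int ^ 'd) \<Rightarrow> 'j \<times> (int ^ 'd) \<Rightarrow> complex" where
  "matrix_product J A B = (\<lambda>jm kn. \<Sum>\<^sub>\<infinity>il\<in>J \<times> UNIV. A jm il * B il kn)"

end

theory Submission
  imports Defs
begin

text \<open>
  The anisotropic norm is comparable with \<open>max\<^sub>i \<bar>x\<^sub>i\<bar> powr (1 / a\<^sub>i)\<close>, which satisfies the
  triangle inequality because all \<open>a\<^sub>i > 1\<close> and whose balls are boxes of volume
  \<open>2 ^ d * r powr \<nu>\<close>. Comparing volumes of disjoint boxes in dyadic shells bounds
  \<open>\<Sum> (r\<^sub>i / T) powr \<nu> * (1 + \<bar>z\<^sub>i - y\<bar> / T) powr (- L)\<close> for \<open>L > \<nu>\<close>; this applies both to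
  the sample points on a fixed level and to the frequencies \<open>\<xi>\<^sub>j\<close>, which are separated by the
  disjointness of the small balls. The product of two weights with scales
  \<open>\<sigma> \<ge> \<tau>\<close> is at most the coarser weight between the end points times a summable weight, so
  the sum over the sample points costs only \<open>max 1 (t\<^sub>i / max t\<^sub>j t\<^sub>k) powr \<nu>\<close>
  and \<open>max 1 (min t\<^sub>j t\<^sub>k / t\<^sub>i) powr L\<close>. The ratio factors are submultiplicative, with a
  surplus power when \<open>t\<^sub>i\<close> lies outside the interval between \<open>t\<^sub>j\<close> and \<open>t\<^sub>k\<close>; inside it a power of
  \<open>t\<^sub>j / t\<^sub>k\<close> is gained by passing from \<open>\<delta>\<close> to \<open>\<delta> / 2\<close>. These gains make the sum over \<open>i\<close>
  converge.
\<close>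

subsection \<open>The anisotropic norm\<close>

definition coord_norm :: "real ^ 'd \<Rightarrow> real ^ 'd \<Rightarrow> real" where
  "coord_norm \<a> x = (MAX i. \<bar>x $ i\<bar> powr (1 / \<a> $ i))"

text \<open>This is the closed \<open>coord_norm\<close> ball when \<open>r \<ge> 0\<close>; in the
  form of a coordinate box its Lebesgue measure is a product of side lengths.\<close>

definition abox :: "real ^ 'd \<Rightarrow> real ^ 'd \<Rightarrow> real \<Rightarrow> (real ^ 'd) set" where
  "abox \<a> z r = cbox (\<chi> i. z $ i - r powr (\<a> $ i)) (\<chi> i. z $ i + r powr (\<a> $ i))"

lemma coord_norm_le_iff:
  fixes \<a> x :: "real ^ 'd"
  assumes "\<And>i. \<a> $ i > 0" "r \<ge> 0"
  shows "coord_norm \<a> x \<le> r \<longleftrightarrow> (\<forall>i. \<bar>x $ i\<bar> \<le> r powr (\<a> $ i))"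
proof -
  have *: "\<bar>x $ i\<bar> powr (1 / \<a> $ i) \<le> r \<longleftrightarrow> \<bar>x $ i\<bar> \<le> r powr (\<a> $ i)" for i
  proof
    assume "\<bar>x $ i\<bar> powr (1 / \<a> $ i) \<le> r"
    then have "(\<bar>x $ i\<bar> powr (1 / \<a> $ i)) powr (\<a> $ i) \<le> r powr (\<a> $ i)"
      using assms(1)[of i] by (intro powr_mono2) auto
    then show "\<bar>x $ i\<bar> \<le> r powr (\<a> $ i)"
      using assms(1)[of i] by (simp add: powr_powr)
  next
    assume "\<bar>x $ i\<bar> \<le> r powr (\<a> $ i)"
    then have "\<bar>x $ i\<bar> powr (1 / \<a> $ i) \<le> (r powr (\<a> $ i)) powr (1 / \<a> $ i)"
      using assms(1)[of i] by (intro powr_mono2) auto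
    then show "\<bar>x $ i\<bar> powr (1 / \<a> $ i) \<le> r"
      using assms(1)[of i] assms(2) by (simp add: powr_powr)
  qed
  show ?thesis
    unfolding coord_norm_def using * by (subst Max_le_iff) auto
qed

lemma coord_norm_nonneg: "coord_norm \<a> x \<ge> 0"
  unfolding coord_norm_def by (subst Max_ge_iff) auto

lemma coord_norm_attained: "\<exists>i. coord_norm \<a> x = \<bar>x $ i\<bar> powr (1 / \<a> $ i)"
proof -
  have "coord_norm \<a> x \<in> range (\<lambda>i. \<bar>x $ i\<bar> powr (1 / \<a> $ i))"
    unfolding coord_norm_def by (rule Max_in) auto
  then show ?thesis by auto
qed

lemma abs_nth_le_coord_norm:
  fixes \<a> x :: "real ^ 'd"
  assumes "\<And>i. \<a> $ i > 0"
  shows "\<bar>x $ i\<bar> \<le> coord_norm \<a> x powr (\<a> $ i)"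
  using coord_norm_le_iff[of \<a> "coord_norm \<a> x" x] assms coord_norm_nonneg[of \<a> x] by auto

lemma coord_norm_pos:
  fixes \<a> x :: "real ^ 'd"
  assumes "\<And>i. \<a> $ i > 0" "x \<noteq> 0"
  shows "coord_norm \<a> x > 0"
proof (rule ccontr)
  assume "\<not> ?thesis"
  then have "coord_norm \<a> x = 0" using coord_norm_nonneg[of \<a> x] by simp
  then have "x $ i = 0" for i
    using abs_nth_le_coord_norm[of \<a> x i] assms(1) by simp
  then show False using assms(2) by (simp add: vec_eq_iff)
qed

text \<open>After one factor is split off, the remaining power \<open>p - 1\<close> is nonnegative
  and hence monotone. Applied in each coordinate, this gives \<open>coord_norm\<close> a triangle
  inequality with constant 1.\<close>

lemma powr_superadditive:
  fixes x y p :: real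
  assumes "x \<ge> 0" "y \<ge> 0" "p \<ge> 1"
  shows "x powr p + y powr p \<le> (x + y) powr p"
proof -
  have *: "z powr p = z * z powr (p - 1)" if "z \<ge> 0" for z :: real
    using powr_mult_base[of z "p - 1"] that by simp
  have "x powr p + y powr p = x * x powr (p - 1) + y * y powr (p - 1)"
    using * assms by simp
  also have "\<dots> \<le> x * (x + y) powr (p - 1) + y * (x + y) powr (p - 1)"
    using assms by (intro add_mono mult_left_mono powr_mono2) auto
  also have "\<dots> = (x + y) powr p"
    using *[of "x + y"] assms by (simp add: algebra_simps)
  finally show ?thesis .
qed

lemma coord_norm_triangle:
  fixes \<a> x y :: "real ^ 'd"
  assumes "\<And>i. \<a> $ i > 1"
  shows "coord_norm \<a> (x + y) \<le> coord_norm \<a> x + coord_norm \<a> y"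
proof -
  have pos: "\<And>i. \<a> $ i > 0" using assms less_trans zero_less_one by blast
  have "\<bar>(x + y) $ i\<bar> \<le> (coord_norm \<a> x + coord_norm \<a> y) powr (\<a> $ i)" for i
  proof -
    have "\<bar>(x + y) $ i\<bar> \<le> \<bar>x $ i\<bar> + \<bar>y $ i\<bar>" by simp
    also have "\<dots> \<le> coord_norm \<a> x powr (\<a> $ i) + coord_norm \<a> y powr (\<a> $ i)"
      by (intro add_mono abs_nth_le_coord_norm pos)
    also have "\<dots> \<le> (coord_norm \<a> x + coord_norm \<a> y) powr (\<a> $ i)"
      using assms[of i] by (intro powr_superadditive coord_norm_nonneg) auto
    finally show ?thesis .
  qed
  then show ?thesis
    by (subst coord_norm_le_iff) (auto intro: pos add_nonneg_nonneg coord_norm_nonneg)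
qed

lemma mem_abox_iff:
  fixes \<a> x z :: "real ^ 'd"
  assumes "\<And>i. \<a> $ i > 0" "r \<ge> 0"
  shows "x \<in> abox \<a> z r \<longleftrightarrow> coord_norm \<a> (x - z) \<le> r"
  unfolding coord_norm_le_iff[OF assms] abox_def mem_box_cart
  by (intro iff_allI) (auto simp: abs_le_iff)

lemma measure_abox:
  fixes \<a> z :: "real ^ 'd"
  assumes "r > 0"
  shows "measure lebesgue (abox \<a> z r) = 2 ^ CARD('d) * r powr homdim \<a>"
proof -
  have "measure lebesgue (abox \<a> z r) = (\<Prod>i\<in>UNIV. 2 * r powr (\<a> $ i))"
  proof -
    have "abox \<a> z r \<noteq> {}"
      unfolding abox_def by (simp add: interval_ne_empty_cart)
    then show ?thesis
      unfolding abox_def by (subst measure_completion, simp, subst content_cbox_cart, auto intro!: prod.cong)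
  qed
  also have "\<dots> = 2 ^ CARD('d) * (\<Prod>i\<in>UNIV. r powr (\<a> $ i))"
    by (simp add: prod.distrib)
  also have "(\<Prod>i\<in>UNIV. r powr (\<a> $ i)) = r powr homdim \<a>"
    using assms by (simp add: homdim_def powr_sum)
  finally show ?thesis .
qed

section \<open>Comparison of the anisotropic norm with the coordinate norm\<close>

lemma dilation_mult_vec: "dilation \<a> t *v x = (\<chi> i. t powr (\<a> $ i) * x $ i)"
  by (simp add: dilation_def matrix_vector_mult_def vec_eq_iff if_distrib[of "\<lambda>c. c * _"] cong: if_cong)

text \<open>The squared norm of the dilated vector is continuous and strictly decreasing in
  \<open>t > 0\<close>, so the \<open>THE\<close> in \<open>anorm\<close> has a value. Locating the
  crossing of 1 between two multiples of \<open>coord_norm\<close> compares the two norms at the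
  same time.\<close>

lemma anorm_exists_unique:
  fixes \<a> x :: "real ^ 'd"
  assumes a: "\<And>i. \<a> $ i > 1" and x: "x \<noteq> 0"
  shows "\<exists>t. coord_norm \<a> x \<le> t \<and> t \<le> sqrt CARD('d) * coord_norm \<a> x \<and>
           norm (dilation \<a> (1 / t) *v x) = 1"
    and "\<lbrakk>s > 0; t > 0; norm (dilation \<a> (1 / s) *v x) = 1; norm (dilation \<a> (1 / t) *v x) = 1\<rbrakk>
           \<Longrightarrow> s = t"
proof -
  have pos: "\<And>i. \<a> $ i > 0" using a less_trans zero_less_one by blast
  define N where "N = coord_norm \<a> x"
  have N: "N > 0" unfolding N_def using coord_norm_pos pos x by blast
  define f where "f t = (\<Sum>i\<in>UNIV. ((1 / t) powr (\<a> $ i) * x $ i)\<^sup>2)" for t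
  have f: "norm (dilation \<a> (1 / t) *v x) = 1 \<longleftrightarrow> f t = 1" for t
    by (simp add: dilation_mult_vec norm_vec_def L2_set_def f_def real_sqrt_eq_1_iff)
  \<comment> \<open>The square of \<open>K\<close> is the dimension, so at \<open>K * N\<close> each
    of the \<open>CARD('d)\<close> squares may be as large as \<open>1 / K\<^sup>2\<close>. That
    bound holds because \<open>K powr (\<a> $ i) \<ge> K\<close>.\<close>
  define K where "K = sqrt CARD('d)"
  have d1: "real CARD('d) \<ge> 1" by (simp add: Suc_leI)
  have K: "K \<ge> 1" using d1 by (simp add: K_def)
  \<comment> \<open>The coordinate that attains the maximum in \<open>N\<close> alone contributes
    exactly 1.\<close>
  have lo: "f N \<ge> 1"
  proof -
    obtain i where i: "N = \<bar>x $ i\<bar> powr (1 / \<a> $ i)"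
      using coord_norm_attained unfolding N_def by blast
    have "N powr (\<a> $ i) = \<bar>x $ i\<bar>" using i pos[of i] by (simp add: powr_powr)
    then have "((1 / N) powr (\<a> $ i) * x $ i)\<^sup>2 = 1"
      using N by (simp add: powr_divide power_mult_distrib power_divide) (smt (verit) power2_abs powr_gt_zero zero_less_power divide_self)
    moreover have "((1 / N) powr (\<a> $ i) * x $ i)\<^sup>2 \<le> f N"
      unfolding f_def by (rule member_le_sum) auto
    ultimately show ?thesis by simp
  qed
  have hi: "f (K * N) \<le> 1"
  proof -
    have "((1 / (K * N)) powr (\<a> $ i) * x $ i)\<^sup>2 \<le> 1 / CARD('d)" for i
    proof -
      have "\<bar>(1 / (K * N)) powr (\<a> $ i) * x $ i\<bar> = \<bar>x $ i\<bar> / (K powr (\<a> $ i) * N powr (\<a> $ i))"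
        using K N by (simp add: powr_divide powr_mult abs_mult)
      also have "\<dots> \<le> N powr (\<a> $ i) / (K powr (\<a> $ i) * N powr (\<a> $ i))"
        using abs_nth_le_coord_norm[of \<a> x i] pos by (intro divide_right_mono) (auto simp: N_def)
      also have "\<dots> = 1 / K powr (\<a> $ i)" using N by simp
      also have "\<dots> \<le> 1 / K"
        using K a[of i] powr_mono[of 1 "\<a> $ i" K] by (intro divide_left_mono) auto
      finally have "\<bar>(1 / (K * N)) powr (\<a> $ i) * x $ i\<bar>\<^sup>2 \<le> (1 / K)\<^sup>2"
        by (intro power_mono) auto
      then show ?thesis by (simp add: K_def power_divide)
    qed
    then have "f (K * N) \<le> (\<Sum>i\<in>(UNIV::'d set). 1 / CARD('d))"
      unfolding f_def by (intro sum_mono)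
    then show ?thesis by simp
  qed
  have "continuous_on {N..K * N} f"
    unfolding f_def using N by (intro continuous_intros) auto
  then have "\<exists>t. N \<le> t \<and> t \<le> K * N \<and> f t = 1"
    using lo hi N K by (intro IVT2') auto
  then show "\<exists>t. coord_norm \<a> x \<le> t \<and> t \<le> sqrt CARD('d) * coord_norm \<a> x \<and>
           norm (dilation \<a> (1 / t) *v x) = 1"
    unfolding f N_def K_def by auto
  have mono: "f t < f s" if "0 < s" "s < t" for s t
    unfolding f_def
  proof (rule sum_strict_mono_ex1)
    obtain k where k: "x $ k \<noteq> 0" using x by (auto simp: vec_eq_iff)
    have lt: "((1 / t) powr (\<a> $ i))\<^sup>2 < ((1 / s) powr (\<a> $ i))\<^sup>2" for i
      using that pos[of i] by (intro power_strict_mono powr_less_mono2) (auto simp: field_simps)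
    show "\<forall>i\<in>UNIV. ((1 / t) powr (\<a> $ i) * x $ i)\<^sup>2 \<le> ((1 / s) powr (\<a> $ i) * x $ i)\<^sup>2"
      using less_imp_le[OF lt] by (auto simp: power_mult_distrib intro!: mult_right_mono)
    show "\<exists>i\<in>UNIV. ((1 / t) powr (\<a> $ i) * x $ i)\<^sup>2 < ((1 / s) powr (\<a> $ i) * x $ i)\<^sup>2"
      using lt k by (intro bexI[of _ k]) (auto simp: power_mult_distrib intro!: mult_strict_right_mono)
  qed auto
  show "s = t" if "s > 0" "t > 0" "norm (dilation \<a> (1 / s) *v x) = 1" "norm (dilation \<a> (1 / t) *v x) = 1"
    using mono[of s t] mono[of t s] that unfolding f by (metis less_irrefl linorder_neqE)
qed

lemma anorm_bounds:
  fixes \<a> x :: "real ^ 'd"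
  assumes a: "\<And>i. \<a> $ i > 1"
  shows "coord_norm \<a> x \<le> anorm \<a> x" "anorm \<a> x \<le> sqrt CARD('d) * coord_norm \<a> x"
proof -
  have pos: "\<And>i. \<a> $ i > 0" using a less_trans zero_less_one by blast
  have "coord_norm \<a> x \<le> anorm \<a> x \<and> anorm \<a> x \<le> sqrt CARD('d) * coord_norm \<a> x"
  proof (cases "x = 0")
    case True
    have "coord_norm \<a> x \<le> 0"
      using True pos by (subst coord_norm_le_iff) auto
    then show ?thesis using True coord_norm_nonneg[of \<a> x] by (simp add: anorm_def)
  next
    case False
    obtain t where t: "coord_norm \<a> x \<le> t" "t \<le> sqrt CARD('d) * coord_norm \<a> x"
        "norm (dilation \<a> (1 / t) *v x) = 1"
      using anorm_exists_unique(1)[OF a False] by blast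
    have "t > 0" using t(1) coord_norm_pos[OF pos False] by simp
    have "anorm \<a> x = t"
      unfolding anorm_def using False \<open>t > 0\<close> t(3) anorm_exists_unique(2)[OF a False]
      by (auto intro!: the_equality)
    then show ?thesis using t by simp
  qed
  then show "coord_norm \<a> x \<le> anorm \<a> x" "anorm \<a> x \<le> sqrt CARD('d) * coord_norm \<a> x" by auto
qed

lemma anorm_nonneg:
  fixes \<a> x :: "real ^ 'd"
  assumes "\<And>i. \<a> $ i > 1"
  shows "anorm \<a> x \<ge> 0"
  using anorm_bounds(1)[OF assms] coord_norm_nonneg order_trans by blast

lemma anorm_minus: "anorm \<a> (- x) = anorm \<a> x"
  by (simp add: anorm_def dilation_mult_vec norm_vec_def)

lemma anorm_minus_commute: "anorm \<a> (x - y) = anorm \<a> (y - x)"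
  using anorm_minus[of \<a> "x - y"] by simp

text \<open>Only the passage from \<open>anorm\<close> to \<open>coord_norm\<close> on the left
  costs a factor; the triangle inequality for \<open>coord_norm\<close> and the return to
  \<open>anorm\<close> are free.\<close>

lemma anorm_quasi_triangle:
  fixes \<a> x y z :: "real ^ 'd"
  assumes a: "\<And>i. \<a> $ i > 1"
  shows "anorm \<a> (x - y) \<le> sqrt CARD('d) * (anorm \<a> (x - z) + anorm \<a> (z - y))"
proof -
  have "anorm \<a> (x - y) \<le> sqrt CARD('d) * coord_norm \<a> ((x - z) + (z - y))"
    using anorm_bounds(2)[OF a, of "x - y"] by simp
  also have "\<dots> \<le> sqrt CARD('d) * (anorm \<a> (x - z) + anorm \<a> (z - y))"
    using coord_norm_triangle[OF a, of "x - z" "z - y"]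
      anorm_bounds(1)[OF a, of "x - z"] anorm_bounds(1)[OF a, of "z - y"]
    by (intro mult_left_mono) auto
  finally show ?thesis .
qed

subsection \<open>Weights and ratio factors\<close>

lemma powr_neg_le:
  fixes x y c L :: real
  assumes "0 < x" "0 < c" "x \<le> c * y" "0 \<le> L"
  shows "y powr (- L) \<le> c powr L * x powr (- L)"
proof -
  have "y > 0" using assms by (metis less_le_trans zero_less_mult_pos)
  have "x powr L \<le> (c * y) powr L" using assms by (intro powr_mono2) auto
  also have "\<dots> = c powr L * y powr L" using assms \<open>y > 0\<close> by (simp add: powr_mult)
  finally show ?thesis using assms \<open>y > 0\<close> by (simp add: powr_minus field_simps)
qed

text \<open>
  If \<open>1 + \<tau> D\<close> is not controlled by \<open>1 + \<tau> e\<close>, then \<open>\<tau> D \<ge> 1\<close> up to constants and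
  \<open>D\<close> is controlled by \<open>d\<close>, so that the first factor gains \<open>(\<tau> / \<sigma>) powr L\<close>.
  Without this gain the coarser weight could not be summed over the finer scale.
\<close>

lemma peetre_product:
  fixes \<sigma> \<tau> d e D K L :: real
  assumes "0 < \<tau>" "\<tau> \<le> \<sigma>" "0 \<le> d" "0 \<le> e" "0 \<le> D" "1 \<le> K" "D \<le> K * (d + e)" "0 \<le> L"
  shows "(1 + \<sigma> * d) powr (- L) * (1 + \<tau> * e) powr (- L) \<le>
    (4 * K) powr L * (1 + \<tau> * D) powr (- L) *
      ((1 + \<sigma> * d) powr (- L) + (\<tau> / \<sigma>) powr L * (1 + \<tau> * e) powr (- L))"
proof (cases "1 + \<tau> * D \<le> 4 * K * (1 + \<tau> * e)")
  case True
  have "(1 + \<tau> * e) powr (- L) \<le> (4 * K) powr L * (1 + \<tau> * D) powr (- L)"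
    using True assms by (intro powr_neg_le) (auto intro!: add_pos_nonneg)
  then have "(1 + \<sigma> * d) powr (- L) * (1 + \<tau> * e) powr (- L) \<le>
      (4 * K) powr L * (1 + \<tau> * D) powr (- L) * (1 + \<sigma> * d) powr (- L)"
    by (metis mult.commute mult_right_mono powr_ge_zero)
  also have "\<dots> \<le> (4 * K) powr L * (1 + \<tau> * D) powr (- L) *
      ((1 + \<sigma> * d) powr (- L) + (\<tau> / \<sigma>) powr L * (1 + \<tau> * e) powr (- L))"
    by (intro mult_left_mono) auto
  finally show ?thesis .
next
  case False
  define p where "p = K * (\<tau> * d)"
  define q where "q = K * (\<tau> * e)"
  have D: "\<tau> * D \<le> p + q"
    using mult_left_mono[OF assms(7), of \<tau>] assms(1) unfolding p_def q_def by (simp add: algebra_simps)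
  have q0: "q \<ge> 0" unfolding q_def using assms by simp
  \<comment> \<open>The failed inequality makes \<open>q\<close> less than a quarter of
    \<open>1 + \<tau> * D\<close>, and \<open>K \<ge> 1\<close> absorbs the constant 1, so
    \<open>p\<close> must carry at least half.\<close>
  have "1 + \<tau> * D > 4 * K + 4 * q" using False unfolding q_def by (simp add: algebra_simps)
  then have "1 + \<tau> * D \<le> 2 * p" using D q0 assms(6) by linarith
  \<comment> \<open>The gain arises here, from
    \<open>\<tau> * d = (\<tau> / \<sigma>) * (\<sigma> * d)\<close>.\<close>
  also have "2 * p \<le> (4 * K * (\<tau> / \<sigma>)) * (1 + \<sigma> * d)"
    unfolding p_def using assms by (simp add: field_simps)
  finally have "(1 + \<sigma> * d) powr (- L) \<le> (4 * K * (\<tau> / \<sigma>)) powr L * (1 + \<tau> * D) powr (- L)"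
    using assms by (intro powr_neg_le) (auto intro!: add_pos_nonneg)
  also have "(4 * K * (\<tau> / \<sigma>)) powr L = (4 * K) powr L * (\<tau> / \<sigma>) powr L"
    by (rule powr_mult)
  finally have "(1 + \<sigma> * d) powr (- L) * (1 + \<tau> * e) powr (- L) \<le>
      (4 * K) powr L * (\<tau> / \<sigma>) powr L * (1 + \<tau> * D) powr (- L) * (1 + \<tau> * e) powr (- L)"
    by (rule mult_right_mono) simp
  also have "\<dots> = (4 * K) powr L * (1 + \<tau> * D) powr (- L) *
      ((\<tau> / \<sigma>) powr L * (1 + \<tau> * e) powr (- L))"
    by (simp add: mult_ac)
  also have "\<dots> \<le> (4 * K) powr L * (1 + \<tau> * D) powr (- L) *
      ((1 + \<sigma> * d) powr (- L) + (\<tau> / \<sigma>) powr L * (1 + \<tau> * e) powr (- L))"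
    by (intro mult_left_mono) auto
  finally show ?thesis .
qed

text \<open>The two minima of \<open>ad_bound\<close> are collected here: the explicit one with
  \<open>\<delta> / 2\<close> and the one inside \<open>ad_freq_decay\<close>.\<close>

definition ratio_decay :: "real \<Rightarrow> real \<Rightarrow> real \<Rightarrow> real \<Rightarrow> real" where
  "ratio_decay w \<delta> s t =
     min ((s / t) powr (w + \<delta> / 2)) ((t / s) powr (\<delta> / 2)) *
     min ((s / t) powr (w + \<delta>)) ((t / s) powr \<delta>)"

text \<open>Both minima change branch exactly at \<open>s = t\<close>, so each side of it carries a
  single power. In logarithmic form, inequalities between products become comparisons of
  exponents.\<close>

lemma ratio_decay_eq:
  assumes "0 < s" "0 < t" "0 < w" "0 < \<delta>"
  shows "ratio_decay w \<delta> s t =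
    (if s \<le> t then exp ((2 * w + 3 / 2 * \<delta>) * (ln s - ln t)) else exp (3 / 2 * \<delta> * (ln t - ln s)))"
proof -
  have st: "(s / t) powr c = exp (c * (ln s - ln t))" "(t / s) powr c = exp (c * (ln t - ln s))" for c
    using assms by (simp_all add: powr_def ln_div)
  have "ln s \<le> ln t \<longleftrightarrow> s \<le> t" using assms by simp
  moreover have "exp ((w + \<delta>) * (ln s - ln t)) \<le> exp (\<delta> * (ln t - ln s)) \<longleftrightarrow> ln s \<le> ln t"
    "exp ((w + \<delta> / 2) * (ln s - ln t)) \<le> exp (\<delta> / 2 * (ln t - ln s)) \<longleftrightarrow> ln s \<le> ln t"
  proof -
    have "(w + \<delta>) * (ln s - ln t) \<le> \<delta> * (ln t - ln s) \<longleftrightarrow> (w + 2 * \<delta>) * (ln s - ln t) \<le> 0"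
      by (auto simp: algebra_simps)
    then show "exp ((w + \<delta>) * (ln s - ln t)) \<le> exp (\<delta> * (ln t - ln s)) \<longleftrightarrow> ln s \<le> ln t"
      using assms by (simp add: mult_le_0_iff)
    have "(w + \<delta> / 2) * (ln s - ln t) \<le> \<delta> / 2 * (ln t - ln s) \<longleftrightarrow> (w + \<delta>) * (ln s - ln t) \<le> 0"
      by (auto simp: field_simps)
    then show "exp ((w + \<delta> / 2) * (ln s - ln t)) \<le> exp (\<delta> / 2 * (ln t - ln s)) \<longleftrightarrow> ln s \<le> ln t"
      using assms by (simp add: mult_le_0_iff)
  qed
  ultimately show ?thesis
    unfolding ratio_decay_def st min_def
    by (auto simp flip: exp_add simp: field_simps)
qed

text \<open>If \<open>r\<close> lies outside the interval between \<open>s\<close> and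
  \<open>t\<close>, the excursion is traversed once in each direction and pays both exponents,
  \<open>2 * w + 3 / 2 * \<delta>\<close> and \<open>3 / 2 * \<delta>\<close>. If it lies inside,
  the factors compose exactly, and halving \<open>\<delta>\<close> frees the exponent
  \<open>3 / 4 * \<delta>\<close>, of which \<open>\<delta> / 2\<close> is kept.\<close>

lemma ratio_decay_mult:
  fixes r s t w \<delta> :: real
  assumes "0 < r" "0 < s" "0 < t" "0 < w" "0 < \<delta>"
  shows "ratio_decay w \<delta> s r * ratio_decay w \<delta> r t \<le> ratio_decay w (\<delta> / 2) s t *
    (if r \<le> min s t then (r / min s t) powr (2 * w + 3 * \<delta>)
     else if max s t \<le> r then (max s t / r) powr (2 * w + 3 * \<delta>)
     else (min s t / max s t) powr (\<delta> / 2))"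
proof -
  have P: "\<And>x y c. 0 < x \<Longrightarrow> 0 < y \<Longrightarrow> (x / y) powr c = exp (c * (ln x - ln (y::real)))"
    by (simp add: powr_def ln_div)
  have le: "\<And>x y. 0 < x \<Longrightarrow> 0 < y \<Longrightarrow> x \<le> y \<longleftrightarrow> ln x \<le> ln (y::real)" by simp
  show ?thesis
    using assms
    by (simp add: ratio_decay_eq P min_def max_def)
       (auto simp: le field_simps split: if_splits simp del: ln_le_cancel_iff simp flip: exp_add)
qed

section \<open>Weights along a chain of three scales\<close>

lemma powr_ratio_flip:
  fixes x y p :: real
  assumes "0 < x" "0 < y"
  shows "(x / y) powr (- p) = (y / x) powr p"
  using assms by (simp add: powr_minus powr_divide)

lemma ratio_weight_le:
  fixes d r t p :: real
  assumes "0 < t" "t \<le> r" "0 \<le> d" "0 \<le> p"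
  shows "(1 + d / r) powr (- p) \<le> (r / t) powr p * (1 + d / t) powr (- p)"
  using assms by (intro powr_neg_le) (auto simp: field_simps add_pos_nonneg)

lemma weight_antimono:
  fixes d p p' :: real
  assumes "0 \<le> d" "p' \<le> p"
  shows "(1 + d) powr (- p) \<le> (1 + d) powr (- p')"
  using assms by (intro powr_mono) auto

text \<open>The first factor is the volume ratio of balls of radii \<open>r\<close> and
  \<open>T\<close>; with \<open>N > \<nu>\<close>, sums over separated centres at distance
  \<open>d\<close> from a fixed centre stay bounded.\<close>

definition freq_weight :: "real \<Rightarrow> real \<Rightarrow> real \<Rightarrow> real \<Rightarrow> real \<Rightarrow> real" where
  "freq_weight \<nu> N r T d = (r / T) powr \<nu> * (1 + d / T) powr (- N)"

lemma freq_weight_nonneg: "freq_weight \<nu> N r T d \<ge> 0"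
  by (simp add: freq_weight_def)

text \<open>
  The middle case \<open>s < r < t\<close> is the only one in which composing the decay factors gains
  nothing; there the gain \<open>(s / t) powr (\<delta> / 2)\<close> comes from giving up half of \<open>\<delta>\<close>.
\<close>

lemma chain_bound_aux:
  fixes r s t d1 d2 D K \<nu> w \<delta> :: real
  assumes pos: "0 < r" "0 < s" "0 < \<nu>" "\<nu> \<le> w" "0 < \<delta>" and st: "s \<le> t"
    and d: "0 \<le> d1" "0 \<le> d2" "0 \<le> D" and K: "1 \<le> K" "D \<le> K * (d1 + d2)"
  defines "L \<equiv> w + \<delta> / 2" and "N \<equiv> \<nu> + \<delta> / 2"
  shows "(if r \<le> s then (r / s) powr (2 * w + 3 * \<delta>)
     else if t \<le> r then (t / r) powr (2 * w + 3 * \<delta>) else (s / t) powr (\<delta> / 2)) *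
    (max 1 (r / t) powr \<nu> * max 1 (s / r) powr L) *
    ((1 + d1 / max r s) powr (- L) * (1 + d2 / max t r) powr (- L)) \<le>
    (4 * K) powr L * (1 + D / t) powr (- L) *
     (freq_weight \<nu> N r s d1 + freq_weight \<nu> N r t d1 + freq_weight \<nu> N r t d2)"
proof -
  have t: "0 < t" using pos st by simp
  \<comment> \<open>\<open>L\<close> is the decay exponent that remains after
    \<open>\<delta>\<close> is halved, while \<open>N\<close> only has to exceed
    \<open>\<nu>\<close> for the sum over the centres.\<close>
  have LN: "0 < L" "0 < N" "\<nu> \<le> L" "N \<le> L" using pos by (auto simp: L_def N_def)
  \<comment> \<open>Scales are radii here, reciprocal to those of \<open>peetre_product\<close>, so
    the coarser scale is the larger one.\<close>
  have peetre: "(1 + d1 / \<sigma>) powr (- L) * (1 + d2 / \<tau>) powr (- L) \<le>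
      (4 * K) powr L * (1 + D / \<tau>) powr (- L) *
      ((1 + d1 / \<sigma>) powr (- L) + (\<sigma> / \<tau>) powr L * (1 + d2 / \<tau>) powr (- L))"
    if "0 < \<sigma>" "\<sigma> \<le> \<tau>" for \<sigma> \<tau>
    using peetre_product[of "1 / \<tau>" "1 / \<sigma>" d1 d2 D K L] that d K LN
    by (simp add: field_simps)
  have pw: "(1 + e / T) powr (- L) \<le> (1 + e / T) powr (- N)" if "0 \<le> e" "0 < T" for e T
    using that LN by (intro weight_antimono) auto
  define Q where "Q = (4 * K) powr L * (1 + D / t) powr (- L)"
  have Q: "Q \<ge> 0" by (simp add: Q_def)
  have nn: "freq_weight \<nu> N r s d1 \<ge> 0" "freq_weight \<nu> N r t d1 \<ge> 0" "freq_weight \<nu> N r t d2 \<ge> 0"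
    by (rule freq_weight_nonneg)+
  consider "r \<le> s" | "s < r" "t \<le> r" | "s < r" "r < t" by linarith
  then show ?thesis
  proof cases
    case 1
    \<comment> \<open>The surplus exponent pays for \<open>(s / r) powr L\<close>, and what remains,
      \<open>w + 5 / 2 * \<delta>\<close>, is at least \<open>\<nu>\<close>.\<close>
    have c: "(r / s) powr (2 * w + 3 * \<delta>) * (max 1 (r / t) powr \<nu> * max 1 (s / r) powr L) \<le> (r / s) powr \<nu>"
    proof -
      have "max 1 (r / t) = 1" "max 1 (s / r) = s / r" using 1 st pos t by auto
      then have "(r / s) powr (2 * w + 3 * \<delta>) * (max 1 (r / t) powr \<nu> * max 1 (s / r) powr L)
          = (r / s) powr (2 * w + 3 * \<delta> - L)"
        using powr_ratio_flip[of s r "- L"] pos by (simp flip: powr_add)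
      also have "\<dots> \<le> (r / s) powr \<nu>"
        using 1 pos by (intro powr_mono') (auto simp: L_def)
      finally show ?thesis .
    qed
    have "(r / s) powr (2 * w + 3 * \<delta>) * (max 1 (r / t) powr \<nu> * max 1 (s / r) powr L) *
        ((1 + d1 / s) powr (- L) * (1 + d2 / t) powr (- L)) \<le>
      (r / s) powr \<nu> * (Q * ((1 + d1 / s) powr (- L) + (s / t) powr L * (1 + d2 / t) powr (- L)))"
      using pos st unfolding Q_def by (intro mult_mono[OF c peetre]) auto
    also have "\<dots> = Q * ((r / s) powr \<nu> * (1 + d1 / s) powr (- L) +
        (r / s) powr \<nu> * (s / t) powr L * (1 + d2 / t) powr (- L))"
      by (simp add: algebra_simps)
    also have "\<dots> \<le> Q * (freq_weight \<nu> N r s d1 + freq_weight \<nu> N r t d2)"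
    proof (intro mult_left_mono add_mono Q)
      show "(r / s) powr \<nu> * (1 + d1 / s) powr (- L) \<le> freq_weight \<nu> N r s d1"
        unfolding freq_weight_def using pw d pos by (intro mult_left_mono) auto
      \<comment> \<open>Lowering \<open>L\<close> to \<open>\<nu>\<close> lets this factor complete
        \<open>(r / s) powr \<nu>\<close> to the volume ratio
        \<open>(r / t) powr \<nu>\<close>.\<close>
      have "(s / t) powr L \<le> (s / t) powr \<nu>" using st pos t LN by (intro powr_mono') auto
      then have "(r / s) powr \<nu> * (s / t) powr L \<le> (r / s) powr \<nu> * (s / t) powr \<nu>"
        by (intro mult_left_mono) auto
      also have "\<dots> = (r / t) powr \<nu>" using pos t by (simp flip: powr_mult)
      finally show "(r / s) powr \<nu> * (s / t) powr L * (1 + d2 / t) powr (- L) \<le> freq_weight \<nu> N r t d2"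
        unfolding freq_weight_def using pw d t by (intro mult_mono) auto
    qed
    also have "\<dots> \<le> Q * (freq_weight \<nu> N r s d1 + freq_weight \<nu> N r t d1 + freq_weight \<nu> N r t d2)"
      using nn by (intro mult_left_mono Q) auto
    finally show ?thesis using 1 st by (simp add: Q_def max_absorb1 max_absorb2)
  next
    case 2
    have W: "(1 + e / r) powr (- L) \<le> (r / t) powr N * (1 + e / t) powr (- N)" if "0 \<le> e" for e
      using order_trans[OF pw ratio_weight_le[of t r e N]] that 2 pos t LN by simp
    have P: "(1 + d1 / r) powr (- L) * (1 + d2 / r) powr (- L) \<le>
      ((4 * K) powr L * ((r / t) powr L * (1 + D / t) powr (- L))) *
      ((r / t) powr N * (1 + d1 / t) powr (- N) + (r / t) powr N * (1 + d2 / t) powr (- N))"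
    proof -
      have "(1 + d1 / r) powr (- L) * (1 + d2 / r) powr (- L) \<le>
        (4 * K) powr L * (1 + D / r) powr (- L) * ((1 + d1 / r) powr (- L) + (1 + d2 / r) powr (- L))"
        using peetre[of r r] pos by simp
      also have "\<dots> \<le> ((4 * K) powr L * ((r / t) powr L * (1 + D / t) powr (- L))) *
        ((r / t) powr N * (1 + d1 / t) powr (- N) + (r / t) powr N * (1 + d2 / t) powr (- N))"
        using 2 pos t LN d by (intro mult_mono add_mono W ratio_weight_le) auto
      finally show ?thesis .
    qed
    \<comment> \<open>Moving the weights from scale \<open>r\<close> down to \<open>t\<close> costs
      the exponents \<open>L\<close> and \<open>N\<close>, and the sample points cost
      \<open>\<nu>\<close>. Against the surplus this leaves
      \<open>2 * \<nu> - w - 2 * \<delta>\<close>, which is at most \<open>\<nu>\<close>.\<close>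
    have c: "(t / r) powr (2 * w + 3 * \<delta>) * (max 1 (r / t) powr \<nu> * max 1 (s / r) powr L)
        * ((r / t) powr L * (r / t) powr N) \<le> (r / t) powr \<nu>"
    proof -
      have mm: "max 1 (s / r) = 1" "max 1 (r / t) = r / t" using 2 st pos t by auto
      have "(t / r) powr (2 * w + 3 * \<delta>) * (max 1 (r / t) powr \<nu> * max 1 (s / r) powr L)
          * ((r / t) powr L * (r / t) powr N) = (r / t) powr (\<nu> + L + N - (2 * w + 3 * \<delta>))"
        unfolding mm powr_ratio_flip[OF pos(1) t, symmetric]
        by (simp flip: powr_add) (simp add: algebra_simps)
      also have "\<dots> \<le> (r / t) powr \<nu>"
        using 2 pos t by (intro powr_mono) (auto simp: L_def N_def)
      finally show ?thesis .
    qed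
    have "(t / r) powr (2 * w + 3 * \<delta>) * (max 1 (r / t) powr \<nu> * max 1 (s / r) powr L) *
        ((1 + d1 / r) powr (- L) * (1 + d2 / r) powr (- L)) \<le>
      (t / r) powr (2 * w + 3 * \<delta>) * (max 1 (r / t) powr \<nu> * max 1 (s / r) powr L) *
       (((4 * K) powr L * ((r / t) powr L * (1 + D / t) powr (- L))) *
      ((r / t) powr N * (1 + d1 / t) powr (- N) + (r / t) powr N * (1 + d2 / t) powr (- N)))"
      by (intro mult_left_mono P) auto
    also have "\<dots> = ((t / r) powr (2 * w + 3 * \<delta>) * (max 1 (r / t) powr \<nu> * max 1 (s / r) powr L)
        * ((r / t) powr L * (r / t) powr N)) * (Q * ((1 + d1 / t) powr (- N) + (1 + d2 / t) powr (- N)))"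
      by (simp add: Q_def algebra_simps)
    also have "\<dots> \<le> (r / t) powr \<nu> * (Q * ((1 + d1 / t) powr (- N) + (1 + d2 / t) powr (- N)))"
      using Q by (intro mult_right_mono c) auto
    also have "\<dots> = Q * (freq_weight \<nu> N r t d1 + freq_weight \<nu> N r t d2)"
      by (simp add: freq_weight_def algebra_simps)
    also have "\<dots> \<le> Q * (freq_weight \<nu> N r s d1 + freq_weight \<nu> N r t d1 + freq_weight \<nu> N r t d2)"
      using nn by (intro mult_left_mono Q) auto
    finally show ?thesis using 2 st by (simp add: Q_def max_absorb1 max_absorb2)
  next
    case 3
    have "max 1 (r / t) = 1" "max 1 (s / r) = 1" using 3 pos t by auto
    then have "(s / t) powr (\<delta> / 2) * (max 1 (r / t) powr \<nu> * max 1 (s / r) powr L) *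
        ((1 + d1 / r) powr (- L) * (1 + d2 / t) powr (- L)) \<le>
      (s / t) powr (\<delta> / 2) * (Q * ((1 + d1 / r) powr (- L) + (r / t) powr L * (1 + d2 / t) powr (- L)))"
      using peetre[of r t] pos 3 unfolding Q_def by (auto intro: mult_left_mono)
    also have "\<dots> = Q * ((s / t) powr (\<delta> / 2) * (1 + d1 / r) powr (- L) +
        (s / t) powr (\<delta> / 2) * (r / t) powr L * (1 + d2 / t) powr (- L))"
      by (simp add: algebra_simps)
    also have "\<dots> \<le> Q * (freq_weight \<nu> N r s d1 + freq_weight \<nu> N r t d2)"
    proof (intro mult_left_mono add_mono Q)
      \<comment> \<open>\<open>N\<close> exceeds \<open>\<nu>\<close> by exactly
        \<open>\<delta> / 2\<close>, so the gain \<open>(s / r) powr (\<delta> / 2)\<close> reduces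
        the cost \<open>(r / s) powr N\<close> to the volume ratio.\<close>
      have "(1 + d1 / r) powr (- L) \<le> (r / s) powr N * (1 + d1 / s) powr (- N)"
        using order_trans[OF pw ratio_weight_le[of s r d1 N]] 3 pos d LN by simp
      moreover have "(s / t) powr (\<delta> / 2) \<le> (s / r) powr (\<delta> / 2)"
        using 3 pos by (intro powr_mono2) (auto simp: field_simps)
      ultimately have "(s / t) powr (\<delta> / 2) * (1 + d1 / r) powr (- L) \<le>
          (s / r) powr (\<delta> / 2) * ((r / s) powr N * (1 + d1 / s) powr (- N))"
        by (intro mult_mono) auto
      also have "\<dots> = freq_weight \<nu> N r s d1"
        unfolding freq_weight_def powr_ratio_flip[OF pos(1,2), symmetric] mult.assoc[symmetric]
        by (simp add: N_def flip: powr_add)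
      finally show "(s / t) powr (\<delta> / 2) * (1 + d1 / r) powr (- L) \<le> freq_weight \<nu> N r s d1" .
      have "(s / t) powr (\<delta> / 2) \<le> 1" using st pos t by (intro powr_le1) auto
      moreover have "(r / t) powr L \<le> (r / t) powr \<nu>" using 3 pos t LN by (intro powr_mono') auto
      ultimately have "(s / t) powr (\<delta> / 2) * (r / t) powr L \<le> 1 * (r / t) powr \<nu>"
        by (intro mult_mono) auto
      then show "(s / t) powr (\<delta> / 2) * (r / t) powr L * (1 + d2 / t) powr (- L) \<le> freq_weight \<nu> N r t d2"
        unfolding freq_weight_def using pw d t by (intro mult_mono) auto
    qed
    also have "\<dots> \<le> Q * (freq_weight \<nu> N r s d1 + freq_weight \<nu> N r t d1 + freq_weight \<nu> N r t d2)"
      using nn by (intro mult_left_mono Q) auto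
    finally show ?thesis using 3 st by (simp add: Q_def max_absorb1 max_absorb2)
  qed
qed

text \<open>The surplus factors of \<open>ratio_decay_mult\<close> are fed into
  \<open>chain_bound_aux\<close>. Exchanging \<open>s\<close> with \<open>t\<close> and
  \<open>d1\<close> with \<open>d2\<close> settles the order \<open>t < s\<close>; the four weights
  cover both orders, with one nonnegative term added in each.\<close>

lemma chain_bound:
  fixes r s t d1 d2 D K \<nu> w \<delta> :: real
  assumes pos: "0 < r" "0 < s" "0 < t" "0 < \<nu>" "\<nu> \<le> w" "0 < \<delta>"
    and d: "0 \<le> d1" "0 \<le> d2" "0 \<le> D" and K: "1 \<le> K" "D \<le> K * (d1 + d2)"
  defines "L \<equiv> w + \<delta> / 2" and "N \<equiv> \<nu> + \<delta> / 2"
  shows "ratio_decay w \<delta> s r * ratio_decay w \<delta> r t *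
    (max 1 (r / max s t) powr \<nu> * max 1 (min s t / r) powr L) *
    ((1 + d1 / max r s) powr (- L) * (1 + d2 / max t r) powr (- L)) \<le>
    (4 * K) powr L * (ratio_decay w (\<delta> / 2) s t * (1 + D / max s t) powr (- L)) *
     (freq_weight \<nu> N r s d1 + freq_weight \<nu> N r (max s t) d1 +
      freq_weight \<nu> N r t d2 + freq_weight \<nu> N r (max s t) d2)"
proof -
  define R where "R = (if r \<le> min s t then (r / min s t) powr (2 * w + 3 * \<delta>)
     else if max s t \<le> r then (max s t / r) powr (2 * w + 3 * \<delta>)
     else (min s t / max s t) powr (\<delta> / 2))"
  define V where "V = (max 1 (r / max s t) powr \<nu> * max 1 (min s t / r) powr L) *
    ((1 + d1 / max r s) powr (- L) * (1 + d2 / max t r) powr (- L))"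
  define G where "G = freq_weight \<nu> N r s d1 + freq_weight \<nu> N r (max s t) d1 +
      freq_weight \<nu> N r t d2 + freq_weight \<nu> N r (max s t) d2"
  note nn = freq_weight_nonneg[of \<nu> N r]
  have RV: "R * V \<le> (4 * K) powr L * (1 + D / max s t) powr (- L) * G"
  proof (cases "s \<le> t")
    case True
    then have mm: "min s t = s" "max s t = t" by auto
    have "R * V \<le> (4 * K) powr L * (1 + D / t) powr (- L) *
        (freq_weight \<nu> N r s d1 + freq_weight \<nu> N r t d1 + freq_weight \<nu> N r t d2)"
      using chain_bound_aux[of r s \<nu> w \<delta> t d1 d2 D K] pos d K True
      unfolding R_def V_def L_def N_def mm by (simp only: mult.assoc)
    also have "\<dots> \<le> (4 * K) powr L * (1 + D / max s t) powr (- L) * G"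
      unfolding G_def using True nn[of t d2] by (auto simp: max_absorb2 intro!: mult_left_mono)
    finally show ?thesis .
  next
    case False
    then have mm: "min s t = t" "max s t = s" by auto
    have "R * V \<le> (4 * K) powr L * (1 + D / s) powr (- L) *
        (freq_weight \<nu> N r t d2 + freq_weight \<nu> N r s d2 + freq_weight \<nu> N r s d1)"
      using chain_bound_aux[of r t \<nu> w \<delta> s d2 d1 D K] pos d K False
      unfolding R_def V_def L_def N_def mm add.commute[of d2] max.commute[of _ r]
      by (simp add: mult_ac)
    also have "\<dots> \<le> (4 * K) powr L * (1 + D / max s t) powr (- L) * G"
      unfolding G_def using False nn[of s d1] by (auto simp: max_absorb1 intro!: mult_left_mono)
    finally show ?thesis .
  qed
  have V0: "V \<ge> 0" by (simp add: V_def)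
  have "ratio_decay w \<delta> s r * ratio_decay w \<delta> r t * V \<le> ratio_decay w (\<delta> / 2) s t * R * V"
    unfolding R_def using ratio_decay_mult[of r s t w \<delta>] pos V0 by (intro mult_right_mono) auto
  also have "\<dots> \<le> ratio_decay w (\<delta> / 2) s t * ((4 * K) powr L * (1 + D / max s t) powr (- L) * G)"
    unfolding mult.assoc[of _ R V] by (intro mult_left_mono RV) (simp add: ratio_decay_def)
  finally show ?thesis by (simp add: V_def G_def mult_ac)
qed

subsection \<open>Packing estimates\<close>

text \<open>Volumes of disjoint boxes inside one box add up, and the common factor
  \<open>2 ^ CARD('d)\<close> of \<open>measure_abox\<close> cancels.\<close>

lemma packing_volume:
  fixes \<a> y T and z :: "'i \<Rightarrow> real ^ 'd"
  assumes "finite I" "T > 0" "\<And>i. i \<in> I \<Longrightarrow> r i > 0"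
    and "disjoint_family_on (\<lambda>i. abox \<a> (z i) (r i)) I"
    and "\<And>i. i \<in> I \<Longrightarrow> abox \<a> (z i) (r i) \<subseteq> abox \<a> y T"
  shows "(\<Sum>i\<in>I. r i powr homdim \<a>) \<le> T powr homdim \<a>"
proof -
  have meas: "abox \<a> z' r' \<in> lmeasurable" for z' r'
    by (simp add: abox_def)
  have "2 ^ CARD('d) * (\<Sum>i\<in>I. r i powr homdim \<a>) = (\<Sum>i\<in>I. measure lebesgue (abox \<a> (z i) (r i)))"
    using assms(3) by (simp add: measure_abox sum_distrib_left)
  also have "\<dots> = measure lebesgue (\<Union>i\<in>I. abox \<a> (z i) (r i))"
    using assms(1,4) meas fmeasurableD2
    by (intro measure_finite_Union[symmetric]) (auto intro: fmeasurableD simp del: emeasure_completion)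
  also have "\<dots> \<le> measure lebesgue (abox \<a> y T)"
    using assms(1,5) meas by (intro measure_mono_fmeasurable) (auto intro: fmeasurableD)
  also have "\<dots> = 2 ^ CARD('d) * T powr homdim \<a>"
    using assms(2) by (rule measure_abox)
  finally show ?thesis by simp
qed

text \<open>This is the value of the geometric series over dyadic shells: \<open>2 powr L\<close> is
  lost by rounding distances up to powers of 2, and \<open>2 powr \<nu>\<close> by doubling the
  radius of each shell.\<close>

definition packing_const :: "real \<Rightarrow> real \<Rightarrow> real" where
  "packing_const \<nu> L = 2 powr (L + \<nu>) / (1 - 2 powr (\<nu> - L))"

lemma packing_const_pos: "\<nu> < L \<Longrightarrow> packing_const \<nu> L > 0"
  using powr_less_mono[of "\<nu> - L" 0 2] unfolding packing_const_def by simp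

lemma homdim_pos:
  fixes \<a> :: "real ^ 'd"
  assumes "\<And>i. \<a> $ i > 1"
  shows "homdim \<a> > 0"
  unfolding homdim_def by (intro sum_pos less_trans[OF zero_less_one assms]) auto

text \<open>Assumption \<open>rT\<close> keeps every box centred in the shell of radius
  \<open>2 ^ n * T\<close> inside the box of twice that radius, where \<open>packing_volume\<close>
  applies. The shell bounds then form a geometric series of ratio
  \<open>2 powr (\<nu> - L) < 1\<close>.\<close>

lemma packing_sum_bound:
  fixes \<a> y :: "real ^ 'd" and z :: "'i \<Rightarrow> real ^ 'd"
  assumes a: "\<And>i. \<a> $ i > 1" and L: "homdim \<a> < L"
    and I: "finite I" and T: "T > 0" and r: "\<And>i. i \<in> I \<Longrightarrow> r i > 0"
    and rT: "\<And>i. i \<in> I \<Longrightarrow> r i \<le> max T (anorm \<a> (z i - y))"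
    and disj: "disjoint_family_on (\<lambda>i. abox \<a> (z i) (r i)) I"
  shows "(\<Sum>i\<in>I. (r i / T) powr homdim \<a> * (1 + anorm \<a> (z i - y) / T) powr (- L))
    \<le> packing_const (homdim \<a>) L"
proof -
  have pos: "\<And>i. \<a> $ i > 0" using a less_trans zero_less_one by blast
  define \<nu> where "\<nu> = homdim \<a>"
  have \<nu>: "\<nu> > 0" "\<nu> < L" using homdim_pos[OF a] L by (auto simp: \<nu>_def)
  define u where "u i = anorm \<a> (z i - y) / T" for i
  have u0: "u i \<ge> 0" for i using anorm_nonneg[OF a] T by (simp add: u_def)
  \<comment> \<open>Since \<open>u i \<ge> 0\<close> the logarithm is nonnegative, so
    \<open>nat\<close> truncates nothing; the ceiling loses at most a factor 2.\<close>
  define k where "k i = nat \<lceil>log 2 (1 + u i)\<rceil>" for i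
  have k: "1 + u i \<le> 2 ^ k i" "2 ^ k i \<le> 2 * (1 + u i)" for i
  proof -
    have l0: "log 2 (1 + u i) \<ge> 0" using u0[of i] by simp
    then have "log 2 (1 + u i) \<le> real (k i)" "real (k i) \<le> 1 + log 2 (1 + u i)"
      unfolding k_def by linarith+
    then have "2 powr log 2 (1 + u i) \<le> 2 powr real (k i)"
      "2 powr real (k i) \<le> 2 powr (1 + log 2 (1 + u i))"
      by (auto intro: powr_mono)
    then show "1 + u i \<le> 2 ^ k i" "2 ^ k i \<le> 2 * (1 + u i)"
      using u0[of i] by (auto simp: powr_add powr_realpow)
  qed
  \<comment> \<open>Any common bound of the shell indices serves; a sum, unlike a maximum, also
    covers empty \<open>I\<close>.\<close>
  define m where "m = (\<Sum>i\<in>I. k i)"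
  have km: "k i \<le> m" if "i \<in> I" for i
    unfolding m_def using that I by (intro member_le_sum) auto
  define g where "g n = 2 powr L * (2 ^ n) powr (- L)" for n :: nat
  \<comment> \<open>Dyadic shells: point \<open>i\<close> is counted in every ball of radius \<open>2 ^ n * T\<close> containing it.\<close>
  have shells: "(r i / T) powr \<nu> * (1 + u i) powr (- L)
      \<le> (\<Sum>n\<le>m. if 1 + u i \<le> 2 ^ n then g n * (r i / T) powr \<nu> else 0)" if "i \<in> I" for i
  proof -
    have "(1 + u i) powr (- L) \<le> g (k i)"
      unfolding g_def using k(2)[of i] \<nu> by (intro powr_neg_le) auto
    then have "(r i / T) powr \<nu> * (1 + u i) powr (- L) \<le>
        (if 1 + u i \<le> 2 ^ k i then g (k i) * (r i / T) powr \<nu> else 0)"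
      using k(1)[of i] mult_right_mono[of "(1 + u i) powr (- L)" "g (k i)" "(r i / T) powr \<nu>"]
      by (simp add: mult.commute)
    also have "\<dots> \<le> (\<Sum>n\<le>m. if 1 + u i \<le> 2 ^ n then g n * (r i / T) powr \<nu> else 0)"
      using km[OF that] by (intro member_le_sum) (auto simp: g_def)
    finally show ?thesis .
  qed
  have shell: "(\<Sum>i | i \<in> I \<and> 1 + u i \<le> 2 ^ n. (r i / T) powr \<nu>) \<le> (2 * 2 ^ n) powr \<nu>" for n
  proof -
    define I' where "I' = {i \<in> I. 1 + u i \<le> 2 ^ n}"
    have sub: "abox \<a> (z i) (r i) \<subseteq> abox \<a> y (2 * 2 ^ n * T)" if "i \<in> I'" for i
    proof
      fix x assume x: "x \<in> abox \<a> (z i) (r i)"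
      have i: "i \<in> I" "(1 + u i) * T \<le> 2 ^ n * T"
        using that T by (auto simp: I'_def)
      \<comment> \<open>The right side dominates both arguments of the maximum in \<open>rT\<close>,
        so distance and radius are each at most \<open>2 ^ n * T\<close>.\<close>
      have "(1 + u i) * T = T + anorm \<a> (z i - y)" using T by (simp add: u_def field_simps)
      then have b: "anorm \<a> (z i - y) \<le> 2 ^ n * T" "r i \<le> 2 ^ n * T"
        using i rT[OF i(1)] T anorm_nonneg[OF a, of "z i - y"] by auto
      have "coord_norm \<a> (x - y) \<le> coord_norm \<a> (x - z i) + coord_norm \<a> (z i - y)"
        using coord_norm_triangle[OF a, of "x - z i" "z i - y"] by simp
      also have "\<dots> \<le> r i + anorm \<a> (z i - y)"
        using x r[OF i(1)] anorm_bounds(1)[OF a] by (intro add_mono) (auto simp: mem_abox_iff pos)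
      also have "\<dots> \<le> 2 * 2 ^ n * T" using b by simp
      finally show "x \<in> abox \<a> y (2 * 2 ^ n * T)"
        using T by (simp add: mem_abox_iff pos)
    qed
    have "(\<Sum>i\<in>I'. r i powr \<nu>) \<le> (2 * 2 ^ n * T) powr \<nu>"
      unfolding \<nu>_def
    proof (rule packing_volume)
      show "disjoint_family_on (\<lambda>i. abox \<a> (z i) (r i)) I'"
        using disj by (rule disjoint_family_on_mono[rotated]) (auto simp: I'_def)
    qed (use I T r sub in \<open>auto simp: I'_def\<close>)
    moreover have "(\<Sum>i\<in>I'. (r i / T) powr \<nu>) = (\<Sum>i\<in>I'. r i powr \<nu>) / T powr \<nu>"
      using T r by (subst sum_divide_distrib, intro sum.cong) (auto simp: powr_divide I'_def less_imp_le)
    ultimately show ?thesis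
      using T unfolding I'_def by (simp add: powr_mult divide_le_eq)
  qed
  have geo: "(2 powr (\<nu> - L)) < 1" using \<nu> powr_less_mono[of "\<nu> - L" 0 2] by simp
  have "(\<Sum>i\<in>I. (r i / T) powr \<nu> * (1 + u i) powr (- L)) \<le>
      (\<Sum>i\<in>I. \<Sum>n\<le>m. if 1 + u i \<le> 2 ^ n then g n * (r i / T) powr \<nu> else 0)"
    by (intro sum_mono shells)
  also have "\<dots> = (\<Sum>n\<le>m. \<Sum>i\<in>I. if 1 + u i \<le> 2 ^ n then g n * (r i / T) powr \<nu> else 0)"
    by (rule sum.swap)
  also have "\<dots> = (\<Sum>n\<le>m. g n * (\<Sum>i | i \<in> I \<and> 1 + u i \<le> 2 ^ n. (r i / T) powr \<nu>))"
    using I by (intro sum.cong refl) (auto simp: sum.inter_filter sum_distrib_left intro!: sum.cong)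
  also have "\<dots> \<le> (\<Sum>n\<le>m. g n * (2 * 2 ^ n) powr \<nu>)"
    by (intro sum_mono mult_left_mono shell) (simp add: g_def)
  also have "\<dots> = (\<Sum>n\<le>m. 2 powr (L + \<nu>) * (2 powr (\<nu> - L)) ^ n)"
  proof (intro sum.cong refl)
    fix n :: nat
    have "(2 ^ n) powr p = 2 powr (real n * p)" for p :: real
      by (simp add: powr_powr flip: powr_realpow)
    moreover have "(2 powr (\<nu> - L)) ^ n = 2 powr (real n * (\<nu> - L))"
      by (simp add: powr_powr mult.commute flip: powr_realpow)
    ultimately show "g n * (2 * 2 ^ n) powr \<nu> = 2 powr (L + \<nu>) * (2 powr (\<nu> - L)) ^ n"
      by (simp add: g_def powr_mult flip: powr_add) (simp add: algebra_simps)
  qed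
  also have "\<dots> \<le> 2 powr (L + \<nu>) * (\<Sum>n. (2 powr (\<nu> - L)) ^ n)"
    unfolding sum_distrib_left[symmetric]
    using geo by (intro mult_left_mono sum_le_suminf summable_geometric) auto
  also have "\<dots> = packing_const \<nu> L"
    using geo by (simp add: packing_const_def suminf_geometric)
  finally show ?thesis by (simp add: u_def \<nu>_def)
qed

section \<open>Sums over sample points and over frequencies\<close>

text \<open>\<open>matrix_inv\<close> chooses some two-sided inverse. Dilations multiply in their
  parameter, so \<open>dilation \<a> (1 / t)\<close> is one, and uniqueness of inverses determines
  the choice.\<close>

lemma sample_point_eq:
  assumes "t > 0"
  shows "sample_point \<a> b t n = (\<chi> i. t powr (- \<a> $ i) * (pi / b * of_int (n $ i)))"
proof -
  have mult: "dilation \<a> s ** dilation \<a> s' = dilation \<a> (s * s')" for s s'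
    by (simp add: matrix_matrix_mult_def dilation_def vec_eq_iff if_distrib[of "\<lambda>c. c * _"] powr_mult cong: if_cong)
  have "dilation \<a> 1 = mat 1" by (simp add: dilation_def mat_def vec_eq_iff)
  then have inv: "dilation \<a> t ** dilation \<a> (1 / t) = mat 1" "dilation \<a> (1 / t) ** dilation \<a> t = mat 1"
    using assms by (simp_all add: mult)
  have "matrix_inv (dilation \<a> t) = dilation \<a> (1 / t)"
    unfolding matrix_inv_def
  proof (rule some_equality)
    fix B assume "dilation \<a> t ** B = mat 1 \<and> B ** dilation \<a> t = mat 1"
    then show "B = dilation \<a> (1 / t)"
      by (metis inv(1) matrix_mul_assoc matrix_mul_lid matrix_mul_rid)
  qed (use inv in blast)
  then show ?thesis
    unfolding sample_point_def by (simp add: dilation_mult_vec powr_divide powr_minus_divide vec_eq_iff[of "vec_lambda _"])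
qed

text \<open>Distinct lattice points differ by at least one spacing in some coordinate. There the
  half-width of a box is at most a quarter of the spacing, by \<open>c \<le> pi / (4 * b)\<close>
  together with \<open>c powr (\<a> $ i) \<le> c\<close>.\<close>

lemma disjoint_sample_boxes:
  fixes \<a> :: "real ^ 'd"
  assumes a: "\<And>i. \<a> $ i > 1" and "b > 0" "t > 0" "0 < c" "c \<le> 1" "c \<le> pi / (4 * b)"
  shows "disjoint_family_on (\<lambda>n. abox \<a> (sample_point \<a> b t n) (c / t)) S"
  unfolding disjoint_family_on_def
proof safe
  fix n n' x
  assume nn: "n \<noteq> n'" and x: "x \<in> abox \<a> (sample_point \<a> b t n) (c / t)"
    "x \<in> abox \<a> (sample_point \<a> b t n') (c / t)"
  have pos: "\<And>i. \<a> $ i > 0" using a less_trans zero_less_one by blast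
  obtain i where i: "n $ i \<noteq> n' $ i" using nn by (auto simp: vec_eq_iff)
  define q where "q = t powr (- \<a> $ i)"
  have q: "q > 0" using assms by (simp add: q_def)
  have "(c / t) powr (\<a> $ i) = c powr (\<a> $ i) * q"
    using assms by (simp add: powr_divide q_def powr_minus_divide)
  also have "\<dots> \<le> c * q"
    using assms a[of i] less_imp_le[OF a[of i]] powr_mono'[of 1 "\<a> $ i" c] q by (intro mult_right_mono) auto
  finally have r: "(c / t) powr (\<a> $ i) \<le> c * q" .
  have "\<bar>x $ i - q * (pi / b * of_int (l $ i))\<bar> \<le> c * q"
    if "x \<in> abox \<a> (sample_point \<a> b t l) (c / t)" for l
  proof -
    have "\<bar>(x - sample_point \<a> b t l) $ i\<bar> \<le> (c / t) powr (\<a> $ i)"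
      using that assms by (subst (asm) mem_abox_iff, simp add: pos, simp, subst (asm) coord_norm_le_iff) (auto simp: pos)
    then show ?thesis using r assms by (simp add: sample_point_eq q_def)
  qed
  note * = this[OF x(1)] this[OF x(2)]
  have "\<bar>u - v\<bar> \<le> 2 * e" if "\<bar>w - u\<bar> \<le> e" "\<bar>w - v\<bar> \<le> e" for u v w e :: real
    using that by linarith
  from this[OF *]
  have "\<bar>q * (pi / b * of_int (n $ i)) - q * (pi / b * of_int (n' $ i))\<bar> \<le> 2 * (c * q)" .
  also have "\<dots> \<le> q * (pi / b) / 2"
    using mult_left_mono[OF assms(6), of "2 * q"] q assms by (simp add: field_simps)
  also have "\<dots> < q * (pi / b)"
  proof -
    have "0 < q * (pi / b)" using q assms by simp
    then show ?thesis by (metis field_sum_of_halves less_add_same_cancel1 half_gt_zero)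
  qed
  also have "\<dots> \<le> q * (pi / b) * \<bar>of_int (n $ i - n' $ i)\<bar>"
  proof -
    have "1 \<le> \<bar>n $ i - n' $ i\<bar>" using i by linarith
    then have "1 \<le> \<bar>real_of_int (n $ i - n' $ i)\<bar>" by linarith
    then show ?thesis using q assms mult_left_mono[of 1 _ "q * (pi / b)"] by simp
  qed
  also have "\<dots> = \<bar>q * (pi / b) * of_int (n $ i - n' $ i)\<bar>"
    using q assms by (simp add: abs_mult)
  also have "q * (pi / b) * of_int (n $ i - n' $ i) =
     q * (pi / b * of_int (n $ i)) - q * (pi / b * of_int (n' $ i))"
    by (simp add: algebra_simps)
  finally show "x \<in> {}" by simp
qed

text \<open>The packing bound is used with radii \<open>c / t\<close> and
  \<open>T = 1 / \<tau>\<close>. The volume ratio is the same for all lattice points, and dividing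
  by it produces \<open>(t / \<tau>) powr homdim \<a>\<close>.\<close>

lemma sample_point_sum:
  fixes \<a> :: "real ^ 'd"
  assumes a: "\<And>i. \<a> $ i > 1" and b: "b > 0" and L: "homdim \<a> < L"
  shows "\<exists>C>0. \<forall>t \<tau> y F. 0 < \<tau> \<longrightarrow> \<tau> \<le> t \<longrightarrow> finite F \<longrightarrow>
    (\<Sum>n\<in>F. (1 + \<tau> * anorm \<a> (sample_point \<a> b t n - y)) powr (- L)) \<le> C * (t / \<tau>) powr homdim \<a>"
proof -
  define c where "c = min 1 (pi / (4 * b))"
  have c: "0 < c" "c \<le> 1" "c \<le> pi / (4 * b)" using b by (auto simp: c_def)
  define C where "C = packing_const (homdim \<a>) L / c powr homdim \<a>"
  have "C > 0" using packing_const_pos[OF L] c by (simp add: C_def)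
  moreover have "(\<Sum>n\<in>F. (1 + \<tau> * anorm \<a> (sample_point \<a> b t n - y)) powr (- L)) \<le> C * (t / \<tau>) powr homdim \<a>"
    if \<tau>: "0 < \<tau>" "\<tau> \<le> t" and F: "finite F" for t \<tau> y F
  proof -
    have t: "t > 0" using \<tau> by simp
    have "(\<Sum>n\<in>F. ((c / t) / (1 / \<tau>)) powr homdim \<a> *
        (1 + anorm \<a> (sample_point \<a> b t n - y) / (1 / \<tau>)) powr (- L)) \<le> packing_const (homdim \<a>) L"
    proof (rule packing_sum_bound[OF a L F])
      show "c / t \<le> max (1 / \<tau>) (anorm \<a> (sample_point \<a> b t n - y))" for n
        using \<tau> t mult_mono[of c 1 \<tau> t] c by (intro max.coboundedI1) (simp add: field_simps)
    qed (use \<tau> t c in \<open>auto intro!: disjoint_sample_boxes a b\<close>)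
    moreover have "((c / t) / (1 / \<tau>)) powr homdim \<a> = c powr homdim \<a> / (t / \<tau>) powr homdim \<a>"
      using \<tau> t c by (simp flip: powr_divide)
    ultimately have "c powr homdim \<a> / (t / \<tau>) powr homdim \<a> *
        (\<Sum>n\<in>F. (1 + \<tau> * anorm \<a> (sample_point \<a> b t n - y)) powr (- L)) \<le> packing_const (homdim \<a>) L"
      by (simp add: sum_distrib_left mult.commute)
    then show ?thesis using \<tau> t c by (simp add: C_def field_simps)
  qed
  ultimately show ?thesis by blast
qed

text \<open>No bound of \<open>t i\<close> by \<open>T\<close> is imposed: for
  \<open>i \<noteq> j\<close> the centre of ball \<open>j\<close> lies outside ball
  \<open>i\<close>, so \<open>\<eta> * t i\<close> is at most the distance of the centres, as
  \<open>packing_sum_bound\<close> requires.\<close>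

lemma separated_points_sum:
  fixes \<a> :: "real ^ 'd" and \<xi> :: "'j \<Rightarrow> real ^ 'd"
  assumes a: "\<And>i. \<a> $ i > 1" and L: "homdim \<a> < L" and \<eta>: "\<eta> > 0"
    and t: "\<And>j. j \<in> J \<Longrightarrow> t j > 0"
    and disj: "disjoint_family_on (\<lambda>j. aball \<a> (\<xi> j) (\<eta> * t j)) J"
  shows "\<exists>C>0. \<forall>j\<in>J. \<forall>T F. t j \<le> T \<longrightarrow> finite F \<longrightarrow> F \<subseteq> J \<longrightarrow>
    (\<Sum>i\<in>F. (t i / T) powr homdim \<a> * (1 + anorm \<a> (\<xi> i - \<xi> j) / T) powr (- L)) \<le> C"
proof -
  have pos: "\<And>i. \<a> $ i > 0" using a less_trans zero_less_one by blast
  define K where "K = sqrt CARD('d)"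
  have K: "K \<ge> 1" by (simp add: K_def Suc_leI)
  \<comment> \<open>\<open>K\<close> converts \<open>coord_norm\<close> into \<open>anorm\<close>,
    the 2 fits closed boxes into open balls, and the cap 1 serves the case \<open>i = j\<close>,
    where \<open>c * t j \<le> T\<close> is required.\<close>
  define c where "c = min 1 (\<eta> / (2 * K))"
  have c: "0 < c" "c \<le> 1" "K * c < \<eta>" "c \<le> \<eta>"
  proof -
    show "0 < c" "c \<le> 1" using K \<eta> by (auto simp: c_def)
    have "c \<le> \<eta> / (2 * K)" by (simp add: c_def)
    then have *: "2 * (K * c) \<le> \<eta>" using K by (simp add: field_simps)
    then show "K * c < \<eta>" using \<eta> by linarith
    have "c \<le> K * c" using K \<open>0 < c\<close> by simp
    then show "c \<le> \<eta>" using * \<eta> by linarith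
  qed
  have sub: "abox \<a> (\<xi> i) (c * t i) \<subseteq> aball \<a> (\<xi> i) (\<eta> * t i)" if "i \<in> J" for i
  proof
    fix x assume "x \<in> abox \<a> (\<xi> i) (c * t i)"
    then have x: "coord_norm \<a> (x - \<xi> i) \<le> c * t i"
      using t[OF that] c by (subst (asm) mem_abox_iff) (auto simp: pos)
    have "anorm \<a> (\<xi> i - x) \<le> K * (c * t i)"
      using anorm_bounds(2)[OF a, of "x - \<xi> i"] mult_left_mono[OF x, of K] K
      unfolding K_def anorm_minus_commute[of \<a> "\<xi> i"] by linarith
    also have "\<dots> < \<eta> * t i" using c(3) t[OF that] by simp
    finally show "x \<in> aball \<a> (\<xi> i) (\<eta> * t i)" by (simp add: aball_def)
  qed
  define C where "C = packing_const (homdim \<a>) L / c powr homdim \<a>"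
  have "C > 0" using packing_const_pos[OF L] c by (simp add: C_def)
  moreover have "(\<Sum>i\<in>F. (t i / T) powr homdim \<a> * (1 + anorm \<a> (\<xi> i - \<xi> j) / T) powr (- L)) \<le> C"
    if j: "j \<in> J" and T: "t j \<le> T" and F: "finite F" "F \<subseteq> J" for j T F
  proof -
    have T0: "T > 0" using t[OF j] T by simp
    have "(\<Sum>i\<in>F. (c * t i / T) powr homdim \<a> * (1 + anorm \<a> (\<xi> i - \<xi> j) / T) powr (- L))
      \<le> packing_const (homdim \<a>) L"
    proof (rule packing_sum_bound[OF a L F(1) T0])
      fix i assume "i \<in> F"
      then have i: "i \<in> J" using F by blast
      show "0 < c * t i" using c t[OF i] by simp
      show "c * t i \<le> max T (anorm \<a> (\<xi> i - \<xi> j))"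
      proof (cases "i = j")
        case True
        have "c * t j \<le> t j" using c t[OF j] by simp
        then show ?thesis using True T by simp
      next
        case False
        then have "aball \<a> (\<xi> i) (\<eta> * t i) \<inter> aball \<a> (\<xi> j) (\<eta> * t j) = {}"
          using disj i j by (auto simp: disjoint_family_on_def)
        moreover have "\<xi> j \<in> aball \<a> (\<xi> j) (\<eta> * t j)"
          using \<eta> t[OF j] by (simp add: aball_def anorm_def)
        ultimately have "\<xi> j \<notin> aball \<a> (\<xi> i) (\<eta> * t i)" by blast
        then have "\<eta> * t i \<le> anorm \<a> (\<xi> i - \<xi> j)" by (simp add: aball_def)
        moreover have "c * t i \<le> \<eta> * t i" using c t[OF i] by simp
        ultimately show ?thesis by simp
      qed
    next
      show "disjoint_family_on (\<lambda>i. abox \<a> (\<xi> i) (c * t i)) F"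
        unfolding disjoint_family_on_def
        using disj[unfolded disjoint_family_on_def] sub F(2) by blast
    qed
    moreover have "(c * t i / T) powr homdim \<a> = c powr homdim \<a> * (t i / T) powr homdim \<a>" for i
      by (simp flip: powr_mult)
    ultimately have "c powr homdim \<a> *
      (\<Sum>i\<in>F. (t i / T) powr homdim \<a> * (1 + anorm \<a> (\<xi> i - \<xi> j) / T) powr (- L)) \<le> packing_const (homdim \<a>) L"
      by (simp add: sum_distrib_left mult.assoc)
    then show ?thesis using c by (simp add: C_def field_simps)
  qed
  ultimately show ?thesis by blast
qed

subsection \<open>Composition of the bounds\<close>

text \<open>\<open>peetre_product\<close> extracts the weight between \<open>x\<close> and
  \<open>y\<close> from each summand. For \<open>\<tau> \<le> \<sigma>\<close> the sum at scale
  \<open>\<tau>\<close> is larger, but its factor \<open>(\<tau> / \<sigma>) powr L\<close> with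
  \<open>L > homdim \<a>\<close> reduces it to the sum at scale \<open>\<sigma>\<close>.\<close>

lemma sample_point_convolution:
  fixes \<a> :: "real ^ 'd"
  assumes a: "\<And>i. \<a> $ i > 1" and b: "b > 0" and L: "homdim \<a> < L"
  shows "\<exists>C>0. \<forall>t \<sigma> \<tau> x y F. 0 < \<sigma> \<longrightarrow> 0 < \<tau> \<longrightarrow> \<sigma> \<le> t \<longrightarrow> \<tau> \<le> t \<longrightarrow> finite F \<longrightarrow>
    (\<Sum>n\<in>F. (1 + \<sigma> * anorm \<a> (sample_point \<a> b t n - x)) powr (- L) *
            (1 + \<tau> * anorm \<a> (y - sample_point \<a> b t n)) powr (- L)) \<le>
    C * ((t / max \<sigma> \<tau>) powr homdim \<a> * (1 + min \<sigma> \<tau> * anorm \<a> (y - x)) powr (- L))"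
proof -
  obtain C0 where C0: "C0 > 0" and C0_all: "\<forall>t \<tau> y F. 0 < \<tau> \<longrightarrow> \<tau> \<le> t \<longrightarrow> finite F \<longrightarrow>
    (\<Sum>n\<in>F. (1 + \<tau> * anorm \<a> (sample_point \<a> b t n - y)) powr (- L)) \<le> C0 * (t / \<tau>) powr homdim \<a>"
    using sample_point_sum[OF a b L] by (elim exE conjE)
  note C0_sum = C0_all[rule_format]
  define K where "K = sqrt CARD('d)"
  have K: "K \<ge> 1" by (simp add: K_def Suc_leI)
  define C where "C = 2 * (4 * K) powr L * C0"
  have "C > 0" using C0 K by (simp add: C_def)
  have \<nu>: "homdim \<a> > 0" by (rule homdim_pos[OF a])
  have core: "(\<Sum>n\<in>F. (1 + \<sigma> * anorm \<a> (sample_point \<a> b t n - x)) powr (- L) *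
            (1 + \<tau> * anorm \<a> (sample_point \<a> b t n - y)) powr (- L)) \<le>
    C * ((t / \<sigma>) powr homdim \<a> * (1 + \<tau> * anorm \<a> (y - x)) powr (- L))"
    if *: "0 < \<tau>" "\<tau> \<le> \<sigma>" "\<sigma> \<le> t" "finite F" for t \<sigma> \<tau> x y F
  proof -
    define X where "X n = (1 + \<sigma> * anorm \<a> (sample_point \<a> b t n - x)) powr (- L)" for n
    define Y where "Y n = (1 + \<tau> * anorm \<a> (sample_point \<a> b t n - y)) powr (- L)" for n
    define Q where "Q = (4 * K) powr L * (1 + \<tau> * anorm \<a> (y - x)) powr (- L)"
    have Q: "Q \<ge> 0" by (simp add: Q_def)
    have "X n * Y n \<le> Q * (X n + (\<tau> / \<sigma>) powr L * Y n)" for n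
      unfolding X_def Y_def Q_def
    proof (rule peetre_product)
      show "anorm \<a> (y - x) \<le> K * (anorm \<a> (sample_point \<a> b t n - x) + anorm \<a> (sample_point \<a> b t n - y))"
        using anorm_quasi_triangle[OF a, of y x "sample_point \<a> b t n"]
        by (simp add: K_def anorm_minus_commute[of \<a> y "sample_point \<a> b t n"] add.commute)
    qed (use * K L \<nu> anorm_nonneg[OF a] in auto)
    then have "(\<Sum>n\<in>F. X n * Y n) \<le> (\<Sum>n\<in>F. Q * (X n + (\<tau> / \<sigma>) powr L * Y n))"
      by (intro sum_mono)
    also have "\<dots> = Q * ((\<Sum>n\<in>F. X n) + (\<tau> / \<sigma>) powr L * (\<Sum>n\<in>F. Y n))"
      by (simp add: sum_distrib_left sum.distrib distrib_left)
    also have "\<dots> \<le> Q * (C0 * (t / \<sigma>) powr homdim \<a> + (\<tau> / \<sigma>) powr homdim \<a> * (C0 * (t / \<tau>) powr homdim \<a>))"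
      unfolding X_def Y_def using * L C0
      by (intro mult_left_mono add_mono mult_mono C0_sum Q powr_mono') (auto intro: sum_nonneg)
    also have "(\<tau> / \<sigma>) powr homdim \<a> * (C0 * (t / \<tau>) powr homdim \<a>) =
        C0 * ((\<tau> / \<sigma>) powr homdim \<a> * (t / \<tau>) powr homdim \<a>)" by simp
    also have "(\<tau> / \<sigma>) powr homdim \<a> * (t / \<tau>) powr homdim \<a> = (t / \<sigma>) powr homdim \<a>"
      using * by (simp flip: powr_mult)
    finally show ?thesis by (simp add: X_def Y_def Q_def C_def algebra_simps)
  qed
  have "(\<Sum>n\<in>F. (1 + \<sigma> * anorm \<a> (sample_point \<a> b t n - x)) powr (- L) *
            (1 + \<tau> * anorm \<a> (y - sample_point \<a> b t n)) powr (- L)) \<le>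
    C * ((t / max \<sigma> \<tau>) powr homdim \<a> * (1 + min \<sigma> \<tau> * anorm \<a> (y - x)) powr (- L))"
    if *: "0 < \<sigma>" "0 < \<tau>" "\<sigma> \<le> t" "\<tau> \<le> t" "finite F" for t \<sigma> \<tau> x y F
  proof (cases "\<tau> \<le> \<sigma>")
    case True
    then show ?thesis
      using core[of \<tau> \<sigma> t F x y] *
      by (simp add: anorm_minus_commute[of \<a> y "sample_point \<a> b t _"] max_absorb1 min_absorb2)
  next
    case False
    then show ?thesis
      using core[of \<sigma> \<tau> t F y x] *
      by (simp add: anorm_minus_commute[of \<a> y "sample_point \<a> b t _"] anorm_minus_commute[of \<a> y x]
          max_absorb2 min_absorb1 mult.commute)
  qed
  with \<open>C > 0\<close> show ?thesis by blast
qed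

section \<open>Almost diagonal bounds along a chain of indices\<close>

lemma ad_bound_eq:
  "ad_bound \<a> b s w \<delta> tj tk \<xi>j \<xi>k m n =
    (tk / tj) powr (s + homdim \<a> / 2) * ratio_decay w \<delta> tj tk *
    (1 + anorm \<a> (\<xi>k - \<xi>j) / max tk tj) powr (- (w + \<delta>)) *
    (1 + min tk tj * anorm \<a> (sample_point \<a> b tk n - sample_point \<a> b tj m)) powr (- (w + \<delta>))"
  by (simp only: ad_bound_def ad_freq_decay_def ratio_decay_def divide_inverse mult_ac
      minus_add_distrib diff_conv_add_uminus)

lemma ratio_decay_nonneg: "ratio_decay w \<delta> s t \<ge> 0"
  by (simp add: ratio_decay_def)

lemma ad_bound_nonneg: "ad_bound \<a> b s w \<delta> tj tk \<xi>j \<xi>k m n \<ge> 0"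
  unfolding ad_bound_eq by (intro mult_nonneg_nonneg ratio_decay_nonneg powr_ge_zero)

lemma ratio_decay_antimono:
  assumes "0 < s" "0 < t" "0 < w" "0 < \<delta>" "\<delta> \<le> \<delta>'"
  shows "ratio_decay w \<delta>' s t \<le> ratio_decay w \<delta> s t"
proof -
  have *: "\<delta> * x \<le> \<delta>' * x" if "x \<ge> 0" for x
    using that assms by (intro mult_right_mono)
  show ?thesis
    using assms *[of "ln t - ln s"] *[of "ln s - ln t"]
    by (auto simp: ratio_decay_eq field_simps)
qed

text \<open>The weights may drop to \<open>\<delta> / 2\<close> at once, which is the parameter of
  the final bound; the ratio factor keeps \<open>\<delta>\<close>, because its surplus is spent in
  \<open>ratio_decay_mult\<close>.\<close>

lemma ad_bound_le:
  fixes \<a> :: "real ^ 'd"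
  assumes a: "\<And>i. \<a> $ i > 1" and "0 < tj" "0 < tk" "0 < w" "0 < \<delta>" "\<delta> \<le> \<delta>'"
  shows "ad_bound \<a> b s w \<delta>' tj tk \<xi>j \<xi>k m n \<le>
    (tk / tj) powr (s + homdim \<a> / 2) * ratio_decay w \<delta> tj tk *
    (1 + anorm \<a> (\<xi>k - \<xi>j) / max tk tj) powr (- (w + \<delta> / 2)) *
    (1 + min tk tj * anorm \<a> (sample_point \<a> b tk n - sample_point \<a> b tj m)) powr (- (w + \<delta> / 2))"
  unfolding ad_bound_eq using assms
  by (intro mult_mono mult_left_mono ratio_decay_antimono weight_antimono)
     (auto intro!: mult_nonneg_nonneg divide_nonneg_pos anorm_nonneg a simp: ratio_decay_def max_def)

text \<open>Convolution leaves a scale that may be smaller than both end scales; this restores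
  \<open>u\<close>, at a cost only when \<open>r < u\<close>.\<close>

lemma min_weight_le:
  fixes r u X L :: real
  assumes "0 < r" "0 < u" "0 \<le> X" "0 \<le> L"
  shows "(1 + min r u * X) powr (- L) \<le> max 1 (u / r) powr L * (1 + u * X) powr (- L)"
proof (rule powr_neg_le)
  show "1 + u * X \<le> max 1 (u / r) * (1 + min r u * X)"
  proof (cases "u \<le> r")
    case True
    then show ?thesis using assms by (simp add: min_absorb2)
  next
    case False
    then show ?thesis using assms by (simp add: min_absorb1 max_absorb2 field_simps)
  qed
qed (use assms in \<open>auto intro!: add_pos_nonneg\<close>)

text \<open>
  \<open>ad_bound\<close> decreases in its parameter \<open>\<delta>\<close>, so the factors may have different ones.
\<close>

lemma ad_chain_bound:
  fixes \<a> :: "real ^ 'd" and \<xi> :: "'j \<Rightarrow> real ^ 'd"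
  assumes a: "\<And>i. \<a> $ i > 1" and b: "b > 0" and w: "homdim \<a> \<le> w" and \<delta>: "\<delta> > 0"
    and \<eta>: "\<eta> > 0" and t: "\<And>j. j \<in> J \<Longrightarrow> t j > 0"
    and disj: "disjoint_family_on (\<lambda>j. aball \<a> (\<xi> j) (\<eta> * t j)) J"
    and le: "\<delta> \<le> \<delta>1" "\<delta> \<le> \<delta>2"
  shows "\<exists>C>0. \<forall>j\<in>J. \<forall>k\<in>J. \<forall>m n F H. finite F \<longrightarrow> F \<subseteq> J \<longrightarrow> finite H \<longrightarrow>
    (\<Sum>i\<in>F. \<Sum>l\<in>H. ad_bound \<a> b s w \<delta>1 (t j) (t i) (\<xi> j) (\<xi> i) m l *
                 ad_bound \<a> b s w \<delta>2 (t i) (t k) (\<xi> i) (\<xi> k) l n)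
    \<le> C * ad_bound \<a> b s w (\<delta> / 2) (t j) (t k) (\<xi> j) (\<xi> k) m n"
proof -
  define \<nu> where "\<nu> = homdim \<a>"
  define L where "L = w + \<delta> / 2"
  define N where "N = \<nu> + \<delta> / 2"
  have \<nu>: "\<nu> > 0" unfolding \<nu>_def by (rule homdim_pos[OF a])
  have LN: "homdim \<a> < L" "homdim \<a> < N" "0 < L" "w > 0" using w \<delta> \<nu> by (auto simp: L_def N_def \<nu>_def)
  define K where "K = sqrt CARD('d)"
  have K: "K \<ge> 1" by (simp add: K_def Suc_leI)
  obtain Cx where Cx: "Cx > 0" and Cx_all: "\<forall>t \<sigma> \<tau> x y F. 0 < \<sigma> \<longrightarrow> 0 < \<tau> \<longrightarrow> \<sigma> \<le> t \<longrightarrow> \<tau> \<le> t \<longrightarrow> finite F \<longrightarrow>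
    (\<Sum>n\<in>F. (1 + \<sigma> * anorm \<a> (sample_point \<a> b t n - x)) powr (- L) *
            (1 + \<tau> * anorm \<a> (y - sample_point \<a> b t n)) powr (- L)) \<le>
    Cx * ((t / max \<sigma> \<tau>) powr \<nu> * (1 + min \<sigma> \<tau> * anorm \<a> (y - x)) powr (- L))"
    using sample_point_convolution[OF a b LN(1), folded \<nu>_def] by (elim exE conjE)
  note Cx_sum = Cx_all[rule_format]
  have "\<exists>C>0. \<forall>j\<in>J. \<forall>T F. t j \<le> T \<longrightarrow> finite F \<longrightarrow> F \<subseteq> J \<longrightarrow>
    (\<Sum>i\<in>F. freq_weight \<nu> N (t i) T (anorm \<a> (\<xi> i - \<xi> j))) \<le> C"
    by (rule separated_points_sum[OF a LN(2) \<eta> t disj, folded \<nu>_def freq_weight_def])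
  then obtain Cf where Cf: "Cf > 0" and Cf_all: "\<forall>j\<in>J. \<forall>T F. t j \<le> T \<longrightarrow> finite F \<longrightarrow> F \<subseteq> J \<longrightarrow>
    (\<Sum>i\<in>F. freq_weight \<nu> N (t i) T (anorm \<a> (\<xi> i - \<xi> j))) \<le> Cf"
    by (elim exE conjE)
  note Cf_sum = Cf_all[rule_format]
  \<comment> \<open>\<open>Cx\<close> comes from the sample points, \<open>(4 * K) powr L\<close>
    from \<open>chain_bound\<close>, and \<open>4 * Cf\<close> from the four weights in
    \<open>G\<close>.\<close>
  define C where "C = Cx * (4 * K) powr L * (4 * Cf)"
  have "C > 0" using Cx Cf K by (simp add: C_def)
  have main: "(\<Sum>i\<in>F. \<Sum>l\<in>H. ad_bound \<a> b s w \<delta>1 (t j) (t i) (\<xi> j) (\<xi> i) m l *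
                 ad_bound \<a> b s w \<delta>2 (t i) (t k) (\<xi> i) (\<xi> k) l n)
    \<le> C * ad_bound \<a> b s w (\<delta> / 2) (t j) (t k) (\<xi> j) (\<xi> k) m n"
    if j: "j \<in> J" and k: "k \<in> J" and F: "finite F" "F \<subseteq> J" and H: "finite H" for j k m n F H
  proof -
    note tj = t[OF j] and tk = t[OF k]
    define e where "e = s + homdim \<a> / 2"
    define x where "x = sample_point \<a> b (t j) m"
    define y where "y = sample_point \<a> b (t k) n"
    define X where "X = anorm \<a> (y - x)"
    have X: "X \<ge> 0" unfolding X_def by (rule anorm_nonneg[OF a])
    define M where "M = max (t j) (t k)"
    define \<mu> where "\<mu> = min (t j) (t k)"
    have \<mu>: "\<mu> > 0" using tj tk by (simp add: \<mu>_def)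
    define D where "D = anorm \<a> (\<xi> k - \<xi> j)"
    define P where "P = (t k / t j) powr e * (1 + \<mu> * X) powr (- L)"
    define E where "E = (4 * K) powr L * (ratio_decay w (\<delta> / 2) (t j) (t k) * (1 + D / M) powr (- L))"
    define G where "G i = freq_weight \<nu> N (t i) (t j) (anorm \<a> (\<xi> i - \<xi> j)) +
       freq_weight \<nu> N (t i) M (anorm \<a> (\<xi> i - \<xi> j)) +
       freq_weight \<nu> N (t i) (t k) (anorm \<a> (\<xi> k - \<xi> i)) +
       freq_weight \<nu> N (t i) M (anorm \<a> (\<xi> k - \<xi> i))" for i
    have P: "P \<ge> 0" and E: "E \<ge> 0" by (simp_all add: P_def E_def ratio_decay_def)
    have inner: "(\<Sum>l\<in>H. ad_bound \<a> b s w \<delta>1 (t j) (t i) (\<xi> j) (\<xi> i) m l *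
                 ad_bound \<a> b s w \<delta>2 (t i) (t k) (\<xi> i) (\<xi> k) l n) \<le> Cx * P * (E * G i)"
      if "i \<in> F" for i
    proof -
      have ti: "t i > 0" using that F(2) t by blast
      define U where "U l = (1 + min (t i) (t j) * anorm \<a> (sample_point \<a> b (t i) l - x)) powr (- L) *
            (1 + min (t k) (t i) * anorm \<a> (y - sample_point \<a> b (t i) l)) powr (- L)" for l
      define Z where "Z = ratio_decay w \<delta> (t j) (t i) * ratio_decay w \<delta> (t i) (t k)"
      define W where "W = (1 + anorm \<a> (\<xi> i - \<xi> j) / max (t i) (t j)) powr (- L) *
          (1 + anorm \<a> (\<xi> k - \<xi> i) / max (t k) (t i)) powr (- L)"
      define V where "V = max 1 (t i / M) powr \<nu> * max 1 (\<mu> / t i) powr L"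
      have ZW: "Z \<ge> 0" "W \<ge> 0" by (auto simp: Z_def W_def ratio_decay_def)
      have regroup: "(a1 * b1 * c1 * d1) * (a2 * b2 * c2 * d2) = (a1 * a2) * (b1 * b2) * (c1 * c2) * (d1 * d2)"
        for a1 b1 c1 d1 a2 b2 c2 d2 :: real by simp
      have "ad_bound \<a> b s w \<delta>1 (t j) (t i) (\<xi> j) (\<xi> i) m l *
           ad_bound \<a> b s w \<delta>2 (t i) (t k) (\<xi> i) (\<xi> k) l n \<le> (t k / t j) powr e * Z * W * U l" for l
      proof -
        have "ad_bound \<a> b s w \<delta>1 (t j) (t i) (\<xi> j) (\<xi> i) m l *
           ad_bound \<a> b s w \<delta>2 (t i) (t k) (\<xi> i) (\<xi> k) l n \<le>
          ((t i / t j) powr e * ratio_decay w \<delta> (t j) (t i) *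
          (1 + anorm \<a> (\<xi> i - \<xi> j) / max (t i) (t j)) powr (- L) *
          (1 + min (t i) (t j) * anorm \<a> (sample_point \<a> b (t i) l - x)) powr (- L)) *
          ((t k / t i) powr e * ratio_decay w \<delta> (t i) (t k) *
          (1 + anorm \<a> (\<xi> k - \<xi> i) / max (t k) (t i)) powr (- L) *
          (1 + min (t k) (t i) * anorm \<a> (y - sample_point \<a> b (t i) l)) powr (- L))"
          unfolding e_def L_def x_def y_def using le
          by (intro mult_mono[OF ad_bound_le[OF a tj ti LN(4) \<delta> le(1)] ad_bound_le[OF a ti tk LN(4) \<delta> le(2)]]
                mult_nonneg_nonneg ratio_decay_nonneg powr_ge_zero ad_bound_nonneg)
        also have "\<dots> = ((t i / t j) powr e * (t k / t i) powr e) * Z * W * U l"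
          unfolding Z_def W_def U_def by (rule regroup)
        also have "(t i / t j) powr e * (t k / t i) powr e = (t k / t j) powr e"
          using ti by (simp flip: powr_mult)
        finally show ?thesis .
      qed
      then have "(\<Sum>l\<in>H. ad_bound \<a> b s w \<delta>1 (t j) (t i) (\<xi> j) (\<xi> i) m l *
           ad_bound \<a> b s w \<delta>2 (t i) (t k) (\<xi> i) (\<xi> k) l n) \<le> (\<Sum>l\<in>H. (t k / t j) powr e * Z * W * U l)"
        by (intro sum_mono)
      also have "\<dots> = (t k / t j) powr e * Z * W * (\<Sum>l\<in>H. U l)"
        by (simp add: sum_distrib_left)
      also have "\<dots> \<le> (t k / t j) powr e * Z * W * (Cx * (V * (1 + \<mu> * X) powr (- L)))"
      proof (intro mult_left_mono)
        \<comment> \<open>Both scales are minima with \<open>t i\<close>, hence at most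
          \<open>t i\<close> as the convolution bound demands. Their maximum is
          \<open>min (t i) M\<close>, which turns the quotient into
          \<open>max 1 (t i / M)\<close>.\<close>
        have "(\<Sum>l\<in>H. U l) \<le> Cx * ((t i / max (min (t i) (t j)) (min (t k) (t i))) powr \<nu> *
            (1 + min (min (t i) (t j)) (min (t k) (t i)) * X) powr (- L))"
          unfolding U_def X_def using ti tj tk H by (intro Cx_sum) auto
        also have "t i / max (min (t i) (t j)) (min (t k) (t i)) = max 1 (t i / M)"
          using ti tj tk by (auto simp: M_def max_def min_def field_simps)
        also have "min (min (t i) (t j)) (min (t k) (t i)) = min (t i) \<mu>"
          by (auto simp: \<mu>_def min_def)
        also have "Cx * (max 1 (t i / M) powr \<nu> * (1 + min (t i) \<mu> * X) powr (- L)) \<le>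
           Cx * (max 1 (t i / M) powr \<nu> * (max 1 (\<mu> / t i) powr L * (1 + \<mu> * X) powr (- L)))"
          using ti \<mu> X LN Cx by (intro mult_left_mono min_weight_le) auto
        finally show "(\<Sum>l\<in>H. U l) \<le> Cx * (V * (1 + \<mu> * X) powr (- L))"
          by (simp add: V_def mult_ac)
      qed (use ZW in auto)
      also have "\<dots> = Cx * P * (Z * V * W)" by (simp add: P_def mult_ac)
      also have "\<dots> \<le> Cx * P * (E * G i)"
      proof (intro mult_left_mono)
        show "Z * V * W \<le> E * G i"
          unfolding Z_def V_def W_def E_def G_def M_def \<mu>_def L_def N_def
        proof (rule chain_bound)
          show "D \<le> K * (anorm \<a> (\<xi> i - \<xi> j) + anorm \<a> (\<xi> k - \<xi> i))"
            using anorm_quasi_triangle[OF a, of "\<xi> k" "\<xi> j" "\<xi> i"]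
            by (simp add: D_def K_def add.commute)
        qed (use ti tj tk \<nu> w \<delta> K anorm_nonneg[OF a] in \<open>auto simp: D_def \<nu>_def\<close>)
      qed (use Cx P in auto)
      finally show ?thesis .
    qed
    have "(\<Sum>i\<in>F. \<Sum>l\<in>H. ad_bound \<a> b s w \<delta>1 (t j) (t i) (\<xi> j) (\<xi> i) m l *
                 ad_bound \<a> b s w \<delta>2 (t i) (t k) (\<xi> i) (\<xi> k) l n) \<le> (\<Sum>i\<in>F. Cx * P * (E * G i))"
      by (intro sum_mono inner)
    also have "\<dots> = Cx * P * (E * (\<Sum>i\<in>F. G i))" by (simp add: sum_distrib_left)
    also have "\<dots> \<le> Cx * P * (E * (Cf + Cf + Cf + Cf))"
    proof (intro mult_left_mono)
      \<comment> \<open>Each frequency sum must be centred at a point of the family with radius at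
        most \<open>T\<close>: the first two at \<open>j\<close>, the last two, after this
        reflection, at \<open>k\<close>.\<close>
      have "anorm \<a> (\<xi> k - \<xi> i) = anorm \<a> (\<xi> i - \<xi> k)" for i
        by (rule anorm_minus_commute)
      then have "(\<Sum>i\<in>F. G i) = (\<Sum>i\<in>F. freq_weight \<nu> N (t i) (t j) (anorm \<a> (\<xi> i - \<xi> j))) +
         (\<Sum>i\<in>F. freq_weight \<nu> N (t i) M (anorm \<a> (\<xi> i - \<xi> j))) +
         (\<Sum>i\<in>F. freq_weight \<nu> N (t i) (t k) (anorm \<a> (\<xi> i - \<xi> k))) +
         (\<Sum>i\<in>F. freq_weight \<nu> N (t i) M (anorm \<a> (\<xi> i - \<xi> k)))"
        by (simp only: G_def sum.distrib)
      also have "\<dots> \<le> Cf + Cf + Cf + Cf"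
        by (rule add_mono[OF add_mono[OF add_mono[OF Cf_sum[OF j _ F] Cf_sum[OF j _ F]] Cf_sum[OF k _ F]] Cf_sum[OF k _ F]])
           (simp_all add: M_def)
      finally show "(\<Sum>i\<in>F. G i) \<le> Cf + Cf + Cf + Cf" .
    qed (use Cx P E in auto)
    also have "\<dots> = C * ((t k / t j) powr e * ratio_decay w (\<delta> / 2) (t j) (t k) *
        (1 + D / M) powr (- L) * (1 + \<mu> * X) powr (- L))"
      by (simp add: C_def P_def E_def mult_ac)
    also have "\<dots> = C * ad_bound \<a> b s w (\<delta> / 2) (t j) (t k) (\<xi> j) (\<xi> k) m n"
      by (simp add: ad_bound_eq e_def D_def M_def \<mu>_def X_def x_def y_def L_def max.commute min.commute)
    finally show ?thesis .
  qed
  show ?thesis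
    by (intro exI[of _ C] conjI ballI allI impI \<open>C > 0\<close> main)
qed

text \<open>The cap at 1 keeps the minimum finite even for infinite \<open>p\<close> and
  \<open>q\<close>, so \<open>enn2real\<close> never takes its default 0 at infinity.\<close>

lemma rmin_bounds:
  assumes "0 < p" "0 < q"
  shows "0 < rmin p q" "rmin p q \<le> 1"
proof -
  have m: "min 1 (min p q) > 0" "min 1 (min p q) \<le> 1" using assms by auto
  then have "min 1 (min p q) < top" using order.strict_trans1 ennreal_one_less_top by blast
  then show "0 < rmin p q" "rmin p q \<le> 1"
    unfolding rmin_def using m by (auto simp: enn2real_positive_iff intro: enn2real_leI)
qed

text \<open>Absolute summability is part of the conclusion because \<open>infsum\<close> is 0 by
  default on families that are not summable; an entry bound alone would not show that the product
  series converge.\<close>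

theorem proposition4p2:
  fixes \<a> :: "real ^ 'd"
    and \<rho> h\<^sub>1 h\<^sub>2 h :: "real ^ 'd \<Rightarrow> real"
    and J :: "'j set"
    and \<xi> :: "'j \<Rightarrow> real ^ 'd"
    and \<delta>\<^sub>0 \<delta>\<^sub>1 a s :: real
    and p q :: ennreal
    and A B :: "'j \<times> (int ^ 'd) \<Rightarrow> 'j \<times> (int ^ 'd) \<Rightarrow> complex"
  assumes anisotropy: "\<And>i. \<a> $ i > 1"
    and hybrid: "hybrid_regulation \<a> \<rho> h\<^sub>1 h\<^sub>2 h"
    and moderate: "d_moderate_const \<a> h \<delta>\<^sub>0"
    and strong: "strongly_moderate \<a> h\<^sub>2"
    and \<delta>\<^sub>1: "0 < \<delta>\<^sub>1" "\<delta>\<^sub>1 < \<delta>\<^sub>0 / 2"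
    and J: "countable J" "infinite J"
    and points: "\<And>j. j \<in> J \<Longrightarrow> \<xi> j \<noteq> 0"
    and covering: "admissible_covering J (\<lambda>j. aball \<a> (\<xi> j) (\<delta>\<^sub>1 * h (\<xi> j))) (- {0})"
    and disjoint: "\<exists>\<delta>\<^sub>1'. 0 < \<delta>\<^sub>1' \<and> \<delta>\<^sub>1' < \<delta>\<^sub>1 \<and>
       disjoint_family_on (\<lambda>j. aball \<a> (\<xi> j) (\<delta>\<^sub>1' * h (\<xi> j))) J"
    and cube: "a > 0" "\<exists>z. aball \<a> 0 (2 * \<delta>\<^sub>1) \<subseteq> cube z a"
    and pq: "0 < p" "0 < q"
    and A: "A \<in> almost_diagonal \<a> h a J \<xi> s p q"
    and B: "B \<in> almost_diagonal \<a> h a J \<xi> s p q"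
  shows "(\<forall>j\<in>J. \<forall>k\<in>J. \<forall>m n.
            (\<lambda>il. norm (A (j, m) il * B il (k, n))) summable_on (J \<times> UNIV)) \<and>
         matrix_product J A B \<in> almost_diagonal \<a> h a J \<xi> s p q"
proof -
  define w where "w = homdim \<a> / rmin p q"
  have w: "homdim \<a> \<le> w"
    using rmin_bounds[OF pq] homdim_pos[OF anisotropy] by (simp add: w_def field_simps mult_left_le)
  have t: "h (\<xi> j) > 0" if "j \<in> J" for j
    using moderate points[OF that] by (simp add: d_moderate_const_def)
  obtain \<eta> where \<eta>: "\<eta> > 0" "disjoint_family_on (\<lambda>j. aball \<a> (\<xi> j) (\<eta> * h (\<xi> j))) J"
    using disjoint by blast
  let ?ad = "\<lambda>\<delta> j k m n. ad_bound \<a> a s w \<delta> (h (\<xi> j)) (h (\<xi> k)) (\<xi> j) (\<xi> k) m n"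
  obtain CA \<delta>A where CA: "CA > 0" "\<delta>A > 0"
    and A_le: "\<And>j k m n. j \<in> J \<Longrightarrow> k \<in> J \<Longrightarrow> norm (A (j, m) (k, n)) \<le> CA * ?ad \<delta>A j k m n"
    using A unfolding almost_diagonal_def w_def by blast
  obtain CB \<delta>B where CB: "CB > 0" "\<delta>B > 0"
    and B_le: "\<And>j k m n. j \<in> J \<Longrightarrow> k \<in> J \<Longrightarrow> norm (B (j, m) (k, n)) \<le> CB * ?ad \<delta>B j k m n"
    using B unfolding almost_diagonal_def w_def by blast
  define \<delta> where "\<delta> = min \<delta>A \<delta>B"
  have \<delta>: "\<delta> > 0" "\<delta> \<le> \<delta>A" "\<delta> \<le> \<delta>B" using CA CB by (auto simp: \<delta>_def)
  have "\<exists>C>0. \<forall>j\<in>J. \<forall>k\<in>J. \<forall>m n F H. finite F \<longrightarrow> F \<subseteq> J \<longrightarrow> finite H \<longrightarrow>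
    (\<Sum>i\<in>F. \<Sum>l\<in>H. ?ad \<delta>A j i m l * ?ad \<delta>B i k l n) \<le> C * ?ad (\<delta> / 2) j k m n"
    by (rule ad_chain_bound[where t = "\<lambda>j. h (\<xi> j)", OF anisotropy cube(1) w \<delta>(1) \<eta>(1) t \<eta>(2) \<delta>(2,3)])
  then obtain C where C: "C > 0" and C_all: "\<forall>j\<in>J. \<forall>k\<in>J. \<forall>m n F H. finite F \<longrightarrow> F \<subseteq> J \<longrightarrow> finite H \<longrightarrow>
    (\<Sum>i\<in>F. \<Sum>l\<in>H. ?ad \<delta>A j i m l * ?ad \<delta>B i k l n) \<le> C * ?ad (\<delta> / 2) j k m n"
    by (elim exE conjE)
  note C_le = C_all[rule_format]
  define C' where "C' = CA * CB * C"
  have C': "C' > 0" using CA CB C by (simp add: C'_def)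
  have fin: "(\<Sum>il\<in>S. norm (A (j, m) il * B il (k, n))) \<le> C' * ?ad (\<delta> / 2) j k m n"
    if j: "j \<in> J" and k: "k \<in> J" and S: "finite S" "S \<subseteq> J \<times> UNIV" for j k m n S
  proof -
    \<comment> \<open>A finite set of index pairs is enlarged to the product of its projections, so
      that the double sum bound of \<open>ad_chain_bound\<close> applies.\<close>
    have fs: "finite (fst ` S)" "finite (snd ` S)" "fst ` S \<subseteq> J" using S by auto
    have "(\<Sum>il\<in>S. norm (A (j, m) il * B il (k, n))) \<le>
        (\<Sum>il\<in>fst ` S \<times> snd ` S. norm (A (j, m) il * B il (k, n)))"
      using fs by (intro sum_mono2) (auto simp: rev_image_eqI)
    also have "\<dots> = (\<Sum>i\<in>fst ` S. \<Sum>l\<in>snd ` S. norm (A (j, m) (i, l) * B (i, l) (k, n)))"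
      by (simp add: sum.cartesian_product)
    also have "\<dots> \<le> (\<Sum>i\<in>fst ` S. \<Sum>l\<in>snd ` S. CA * CB * (?ad \<delta>A j i m l * ?ad \<delta>B i k l n))"
    proof (intro sum_mono)
      fix i l assume "i \<in> fst ` S"
      then have i: "i \<in> J" using fs by blast
      have "norm (A (j, m) (i, l)) * norm (B (i, l) (k, n)) \<le> (CA * ?ad \<delta>A j i m l) * (CB * ?ad \<delta>B i k l n)"
        using order_trans[OF norm_ge_zero A_le[OF j i]] by (intro mult_mono A_le B_le j i k) auto
      then show "norm (A (j, m) (i, l) * B (i, l) (k, n)) \<le> CA * CB * (?ad \<delta>A j i m l * ?ad \<delta>B i k l n)"
        by (simp add: norm_mult mult_ac)
    qed
    also have "\<dots> = CA * CB * (\<Sum>i\<in>fst ` S. \<Sum>l\<in>snd ` S. ?ad \<delta>A j i m l * ?ad \<delta>B i k l n)"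
      by (simp add: sum_distrib_left)
    also have "\<dots> \<le> CA * CB * (C * ?ad (\<delta> / 2) j k m n)"
      using CA CB by (intro mult_left_mono C_le j k fs) auto
    finally show ?thesis by (simp add: C'_def mult_ac)
  qed
  have summable: "(\<lambda>il. norm (A (j, m) il * B il (k, n))) summable_on (J \<times> UNIV)"
    if "j \<in> J" "k \<in> J" for j k m n
    \<comment> \<open>Finite partial sums of nonnegative terms are bounded uniformly by
      \<open>fin\<close>.\<close>
    using fin[OF that] by (intro nonneg_bdd_above_summable_on bdd_aboveI2) auto
  have "norm (matrix_product J A B (j, m) (k, n)) \<le> C' * ?ad (\<delta> / 2) j k m n"
    if "j \<in> J" "k \<in> J" for j k m n
  proof -
    have "norm (matrix_product J A B (j, m) (k, n)) \<le> (\<Sum>\<^sub>\<infinity>il\<in>J \<times> UNIV. norm (A (j, m) il * B il (k, n)))"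
      unfolding matrix_product_def by (intro norm_infsum_bound summable that)
    also have "\<dots> \<le> C' * ?ad (\<delta> / 2) j k m n"
      by (intro infsum_le_finite_sums summable fin that)
    finally show ?thesis .
  qed
  then have "matrix_product J A B \<in> almost_diagonal \<a> h a J \<xi> s p q"
    unfolding almost_diagonal_def w_def[symmetric] using C' half_gt_zero[OF \<delta>(1)] by blast
  with summable show ?thesis by blast
qed

end
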